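(* Let $\gamma$ be a nonnegative random variable whose moment generating function is \[ \mathcal{M}_{\gamma}(s)=\mathbb{E}[e^{s\gamma}]=\prod_{i=1}^n\left(1-\frac{s}{a_i}\right)^{-b_i}, \] where $a_1,\dots,a_n,b_1,\dots,b_n$ are complex numbers with $\operatorname{Re}[a_i]>0$ for $i=1,\dots,n$ and $\sum_{i=1}^n b_i>0$. Write $B=\sum_{i=1}^n b_i$. Then: (i) The cumulative distribution function of $\gamma$ is, for $\gamma\ge 0$, \[ F_\gamma(\gamma)=\frac{\prod_{i=1}^n (a_i)^{b_i}}{\Gamma(1+B)}\,\gamma^{B}\,\Phi_2^{(n)}\!\left(b_1,\dots,b_n;1+B;-a_1\gamma,\dots,-a_n\gamma\right). \] (ii) For every $p>0$, \[ \mathbb{E}\big[Q(\sqrt{p\gamma})\big]=\frac{1}{2\sqrt{\pi}}\left\{\prod_{i=1}^n (a_i)^{b_i}\right\}\frac{\Gamma\left(\tfrac12+B\right)}{\Gamma(1+B)}\left(\frac{2}{p}\right)^{B} F_D^{(n)}\!\left(\tfrac12+B,b_1,\dots,b_n;1+B;-\frac{2a_1}{p},\dots,-\frac{2a_n}{p}\right). \]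
   Context: $Q(x)=\frac{1}{\sqrt{2\pi}}\int_x^\infty e^{-t^2/2}\,dt$ is the Gaussian $Q$-function and $\Gamma$ is the gamma function. The moment generating function of a nonnegative random variable $\gamma$ with density $f_\gamma$ is $\mathcal{M}_\gamma(s)=\mathbb{E}[e^{s\gamma}]$, i.e. the Laplace transform of $f_\gamma$ evaluated at $-s$; powers of complex numbers use the principal branch. With $(x)_m$ the Pochhammer symbol, the confluent Lauricella function is $\Phi_2^{(n)}(b_1,\dots,b_n;c;x_1,\dots,x_n)=\sum_{m_1,\dots,m_n\ge0}\frac{(b_1)_{m_1}\cdots(b_n)_{m_n}}{(c)_{m_1+\cdots+m_n}}\frac{x_1^{m_1}\cdots x_n^{m_n}}{m_1!\cdots m_n!}$, and the Lauricella function $F_D^{(n)}(a,b_1,\dots,b_n;c;x_1,\dots,x_n)=\sum_{m_1,\dots,m_n\ge0}\frac{(a)_{m_1+\cdots+m_n}(b_1)_{m_1}\cdots(b_n)_{m_n}}{(c)_{m_1+\cdots+m_n}}\frac{x_1^{m_1}\cdots x_n^{m_n}}{m_1!\cdots m_n!}$ for $|x_i|<1$, extended elsewhere by analytic continuation. *)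

theory Defs
  imports "HOL-Probability.Probability"
begin

definition Qfun :: "real \<Rightarrow> real" where
  "Qfun x = (1 / sqrt (2 * pi)) * (LBINT t:{x..}. exp (- (t\<^sup>2) / 2))"

definition multi_idx :: "nat \<Rightarrow> (nat \<Rightarrow> nat) set" where
  "multi_idx n = {m. \<forall>i\<ge>n. m i = 0}"

text \<open>Confluent Lauricella function Phi_2^(n) (entire; defined by its series).\<close>
definition Phi2 :: "nat \<Rightarrow> (nat \<Rightarrow> complex) \<Rightarrow> complex \<Rightarrow> (nat \<Rightarrow> complex) \<Rightarrow> complex" where
  "Phi2 n b c x = (\<Sum>\<^sub>\<infinity>m\<in>multi_idx n.
      (\<Prod>i<n. pochhammer (b i) (m i)) / pochhammer c (\<Sum>i<n. m i)
      * (\<Prod>i<n. x i ^ m i / of_nat (fact (m i))))"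

text \<open>Defining series of the Lauricella function F_D^(n) (for |x_i| < 1).\<close>
definition FD_series :: "nat \<Rightarrow> complex \<Rightarrow> (nat \<Rightarrow> complex) \<Rightarrow> complex \<Rightarrow> (nat \<Rightarrow> complex) \<Rightarrow> complex" where
  "FD_series n a b c x = (\<Sum>\<^sub>\<infinity>m\<in>multi_idx n.
      pochhammer a (\<Sum>i<n. m i) * (\<Prod>i<n. pochhammer (b i) (m i)) / pochhammer c (\<Sum>i<n. m i)
      * (\<Prod>i<n. x i ^ m i / of_nat (fact (m i))))"

text \<open>Domain of the analytic continuation: Re x_i < 1 for all i < n (a convex set
  containing the unit polydisk).\<close>
definition FD_dom :: "nat \<Rightarrow> (nat \<Rightarrow> complex) set" where
  "FD_dom n = {x. \<forall>i<n. Re (x i) < 1}"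

text \<open>g is an analytic continuation of the F_D series to FD_dom n: it agrees with the series
  on the unit polydisk and is holomorphic in each variable separately on FD_dom n
  (normalised to 0 outside the domain so that it is unique).\<close>
definition FD_continuation :: "nat \<Rightarrow> complex \<Rightarrow> (nat \<Rightarrow> complex) \<Rightarrow> complex \<Rightarrow> ((nat \<Rightarrow> complex) \<Rightarrow> complex) \<Rightarrow> bool" where
  "FD_continuation n a b c g \<longleftrightarrow>
     (\<forall>x. (\<forall>i<n. norm (x i) < 1) \<longrightarrow> g x = FD_series n a b c x) \<and>
     (\<forall>x\<in>FD_dom n. \<forall>j<n. (\<lambda>z. g (x(j := z))) holomorphic_on {z. Re z < 1}) \<and>
     (\<forall>x. x \<notin> FD_dom n \<longrightarrow> g x = 0)"

definition lauricella_FD :: "nat \<Rightarrow> complex \<Rightarrow> (nat \<Rightarrow> complex) \<Rightarrow> complex \<Rightarrow> (nat \<Rightarrow> complex) \<Rightarrow> complex" where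
  "lauricella_FD n a b c x = (THE g. FD_continuation n a b c g) x"

end

(*
  Grouping the defining series by total degree turns Phi_2 and F_D into power series in one real
  variable whose coefficients are those of prod_i (1 - x_i t)^(-b_i).

  (i) Integrating termwise, the Laplace transform of the claimed distribution function at a large u
  is prod_i (1 + u/a_i)^(-b_i) / u, which is also the Laplace transform of the distribution function
  of X.  Both functions are right continuous, so they agree: after the substitution y = exp(-t),
  Bernstein polynomials show that a function all of whose Laplace moments vanish is zero.

  (ii) Craig's formula writes Q(sqrt y) as the integral of exp(-y/(2t)) / (2 pi) against the weight
  t^(-1/2) (1-t)^(-1/2) on (0,1).  By Fubini, E[Q(sqrt(p X))] becomes an integral of the moment
  generating function, and rewriting its factors yields Euler's integral for F_D.  That integral is
  holomorphic in each variable on Re x_i < 1 and agrees with the series on the unit polydisc, so it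
  is the analytic continuation.
*)
theory Submission
  imports Defs "HOL-Complex_Analysis.Complex_Analysis"
begin

section \<open>Series over multi-indices\<close>

text \<open>The generating function is given only on the real half line s <= 0, and the expansion in
  a_i / u converges only for u > |a_i|. The transforms in (i) are therefore compared at large real u
  only, without complex inversion; equality along one progression u0, u0 + 1, ... is enough, because
  the functions exp(-k t) are the monomials in y = exp(-t). In (ii) the arguments -2 a_i / p may
  leave the unit polydisc, where the series no longer defines F_D. If Re x_i < 1, then 1 - x_i t
  stays in the right half plane for 0 <= t <= 1, away from the branch cut of the principal power;
  this is why Euler's integral makes sense on that domain. The b_i may be complex, but their sum B
  is real, so the powers of a real variable collect into one real power. In (ii) this is t^B, which
  moves the beta parameters from (1/2, 1/2) to (1/2 + B, 1/2) and so produces the parameters 1/2 + B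
  and 1 + B of F_D.\<close>

lemma multi_idx_0: "multi_idx 0 = {\<lambda>_. 0}"
  by (auto simp: multi_idx_def)

text \<open>Overwriting position n identifies multi-indices in n + 1 variables with pairs, so that
  sums over them become iterated sums.\<close>

lemma multi_idx_Suc: "multi_idx (Suc n) = (\<lambda>(m, j). m(n := j)) ` (multi_idx n \<times> UNIV)"
proof (intro equalityI subsetI)
  fix m assume "m \<in> multi_idx (Suc n)"
  then have "m(n := 0) \<in> multi_idx n" "m = (m(n := 0))(n := m n)"
    by (auto simp: multi_idx_def)
  then show "m \<in> (\<lambda>(m, j). m(n := j)) ` (multi_idx n \<times> UNIV)"
    by (intro image_eqI[where x="(m(n := 0), m n)"]) auto
qed (auto simp: multi_idx_def)

lemma inj_on_multi_idx_upd: "inj_on (\<lambda>(m, j). m(n := j)) (multi_idx n \<times> UNIV)"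
proof (rule inj_on_inverseI[where g="\<lambda>m. (m(n := 0), m n)"])
  fix p assume "p \<in> multi_idx n \<times> (UNIV :: nat set)"
  then have "fst p n = 0" by (auto simp: multi_idx_def)
  then have "(fst p)(n := 0) = fst p" by (rule fun_upd_idem)
  then show "(\<lambda>m. (m(n := 0), m n)) ((\<lambda>(m, j). m(n := j)) p) = p"
    by (simp add: case_prod_unfold)
qed

text \<open>Distributivity for infinite sums, by induction on the number of coordinates. Absolute
  summability is carried along because splitting a sum over pairs depends on it.\<close>

lemma has_sum_multi_idx_prod:
  fixes f :: "nat \<Rightarrow> nat \<Rightarrow> 'a::{real_normed_field, banach}"
  assumes "\<And>i. i < n \<Longrightarrow> summable (\<lambda>k. norm (f i k))"
  shows "(\<lambda>m. norm (\<Prod>i<n. f i (m i))) summable_on multi_idx n"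
    and "((\<lambda>m. \<Prod>i<n. f i (m i)) has_sum (\<Prod>i<n. \<Sum>k. f i k)) (multi_idx n)"
proof -
  have "(\<lambda>m. norm (\<Prod>i<n. f i (m i))) summable_on multi_idx n \<and>
    ((\<lambda>m. \<Prod>i<n. f i (m i)) has_sum (\<Prod>i<n. \<Sum>k. f i k)) (multi_idx n)"
    using assms
  proof (induction n)
    case 0
    show ?case by (auto simp: multi_idx_0 has_sum_finite_iff)
  next
    case (Suc n)
    let ?F = "\<lambda>m. \<Prod>i<n. f i (m i)" and ?u = "\<lambda>(m::nat \<Rightarrow> nat, j). m(n := j)"
    have IH1: "(\<lambda>m. norm (?F m)) summable_on multi_idx n"
      and IH2: "(?F has_sum (\<Prod>i<n. \<Sum>k. f i k)) (multi_idx n)"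
      using Suc by auto
    have fn: "summable (\<lambda>k. norm (f n k))" using Suc.prems by auto
    have fabs: "(\<lambda>k. norm (f n k)) summable_on UNIV"
      using norm_summable_imp_summable_on[where f="\<lambda>k. norm (f n k)"] fn by simp
    have fsum: "(f n has_sum (\<Sum>k. f n k)) UNIV"
      using fn norm_summable_imp_has_sum summable_norm_cancel summable_sums by blast
    have eq: "(\<lambda>m. \<Prod>i<Suc n. f i (m i)) \<circ> ?u = (\<lambda>(m, j). ?F m * f n j)"
    proof
      fix x :: "(nat \<Rightarrow> nat) \<times> nat"
      have "(\<Prod>i<n. f i (((fst x)(n := snd x)) i)) = (\<Prod>i<n. f i (fst x i))"
        by (intro prod.cong) auto
      then show "((\<lambda>m. \<Prod>i<Suc n. f i (m i)) \<circ> ?u) x = (\<lambda>(m, j). ?F m * f n j) x"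
        by (simp add: case_prod_unfold)
    qed
    have abs: "(\<lambda>z. norm ((\<lambda>(m, j). ?F m * f n j) z)) summable_on (multi_idx n \<times> UNIV)"
      using IH1 fabs
      by (subst Infinite_Sum.abs_summable_on_Sigma_iff)
        (auto simp: norm_mult infsum_cmult_right' abs_mult infsum_nonneg
          intro!: summable_on_cmult_right summable_on_cmult_left)
    have "((\<lambda>(m, j). ?F m * f n j) has_sum ((\<Prod>i<n. \<Sum>k. f i k) * (\<Sum>k. f n k))) (multi_idx n \<times> UNIV)"
      by (rule has_sum_SigmaI[OF _ has_sum_cmult_left[OF IH2] abs_summable_summable[OF abs]])
         (simp add: has_sum_cmult_right fsum)
    then show ?case
      using abs inj_on_multi_idx_upd[of n]
      unfolding multi_idx_Suc eq[symmetric]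
      by (subst has_sum_reindex, simp, subst summable_on_reindex, simp) (simp add: o_def case_prod_unfold)
  qed
  then show "(\<lambda>m. norm (\<Prod>i<n. f i (m i))) summable_on multi_idx n"
    "((\<lambda>m. \<Prod>i<n. f i (m i)) has_sum (\<Prod>i<n. \<Sum>k. f i k)) (multi_idx n)" by auto
qed

text \<open>The coefficient of t^k in the product of the (1 - x_i t)^(-b_i), as
  \<open>prod_powr_sums\<close> shows. Only finitely many multi-indices have degree k, so a finite
  sum serves.\<close>

definition deg_coeff :: "nat \<Rightarrow> (nat \<Rightarrow> complex) \<Rightarrow> (nat \<Rightarrow> complex) \<Rightarrow> nat \<Rightarrow> complex" where
  "deg_coeff n b x k = (\<Sum>m | m \<in> multi_idx n \<and> (\<Sum>i<n. m i) = k.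
     \<Prod>i<n. pochhammer (b i) (m i) * x i ^ m i / fact (m i))"

lemma finite_multi_idx_deg: "finite {m \<in> multi_idx n. (\<Sum>i<n. m i) = k}"
proof (rule finite_subset)
  show "{m \<in> multi_idx n. (\<Sum>i<n. m i) = k}
      \<subseteq> {m. \<forall>i. (i \<in> {..<n} \<longrightarrow> m i \<in> {..k}) \<and> (i \<notin> {..<n} \<longrightarrow> m i = 0)}"
    by (auto simp: multi_idx_def intro: member_le_sum)
qed (rule finite_set_of_finite_funs; simp)

section \<open>The binomial series in Pochhammer form\<close>

lemma gbinomial_uminus_pochhammer: "((- b) gchoose k) * (- z) ^ k = pochhammer b k * z ^ k / (fact k :: complex)"
proof -
  have "((- 1) ^ k * (- z) ^ k :: complex) = z ^ k" by (simp flip: power_mult_distrib)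
  then show ?thesis unfolding gbinomial_pochhammer
    by (metis (no_types, opaque_lifting) add.inverse_inverse mult.assoc mult.commute times_divide_eq_left)
qed

lemma negative_binomial_complex:
  fixes z b :: complex
  assumes "norm z < 1"
  shows "summable (\<lambda>k. norm (pochhammer b k * z ^ k / fact k))"
    and "(\<lambda>k. pochhammer b k * z ^ k / fact k) sums ((1 - z) powr (- b))"
proof -
  have s: "(\<lambda>k. pochhammer b k * w ^ k / fact k) sums ((1 - w) powr (- b))" if "norm w < 1" for w
    using gen_binomial_complex[of "- w" "- b"] that by (simp add: gbinomial_uminus_pochhammer)
  show "(\<lambda>k. pochhammer b k * z ^ k / fact k) sums ((1 - z) powr (- b))"
    using assms by (rule s)
  \<comment> \<open>Convergence at a real point strictly between |z| and 1 forces absolute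
    convergence at z.\<close>
  obtain r where r: "norm z < r" "r < 1" using assms dense by blast
  then have "norm (complex_of_real r) < 1" using norm_ge_zero[of z] unfolding norm_of_real by linarith
  from sums_summable[OF s[OF this]]
  have "summable (\<lambda>k. (pochhammer b k / fact k) * (complex_of_real r) ^ k)" by (simp add: field_simps)
  from powser_insidea[OF this, of z] r norm_ge_zero[of z]
  show "summable (\<lambda>k. norm (pochhammer b k * z ^ k / fact k))" by (simp add: field_simps)
qed

text \<open>A weight depending only on the total degree can be collected degree by degree. The bound
  C r^k dominates the sum by a product of binomial series at r x_i, whose absolute summability
  permits the regrouping. It serves for the weights t^k (r = t), (a)_k / (c)_k (r = 1) and t^k /
  (c)_k (r as small as needed).\<close>

lemma weighted_multi_sum:
  fixes b x :: "nat \<Rightarrow> complex" and w :: "nat \<Rightarrow> complex"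
  assumes "0 \<le> r" "\<And>i. i < n \<Longrightarrow> norm (x i) * r < 1" "\<And>k. norm (w k) \<le> C * r ^ k"
  shows "((\<lambda>k. w k * deg_coeff n b x k) has_sum
     (\<Sum>\<^sub>\<infinity>m\<in>multi_idx n. w (\<Sum>i<n. m i) * (\<Prod>i<n. pochhammer (b i) (m i) * x i ^ m i / fact (m i)))) UNIV"
proof -
  let ?d = "\<lambda>m::nat \<Rightarrow> nat. \<Sum>i<n. m i"
  let ?P = "\<lambda>m. \<Prod>i<n. pochhammer (b i) (m i) * x i ^ m i / fact (m i)"
  define f where "f i k = pochhammer (b i) k * (complex_of_real r * x i) ^ k / fact k" for i k
  have "(\<lambda>m. norm (\<Prod>i<n. f i (m i))) summable_on multi_idx n"
    unfolding f_def using assms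
    by (intro has_sum_multi_idx_prod negative_binomial_complex) (auto simp: norm_mult mult.commute)
  then have *: "(\<lambda>m. C * norm (\<Prod>i<n. f i (m i))) summable_on multi_idx n"
    by (intro summable_on_cmult_right) simp
  have f_eq: "norm (\<Prod>i<n. f i (m i)) = r ^ ?d m * norm (?P m)" for m
  proof -
    have "(\<Prod>i<n. f i (m i)) = (\<Prod>i<n. complex_of_real r ^ m i * (pochhammer (b i) (m i) * x i ^ m i / fact (m i)))"
      by (simp add: f_def power_mult_distrib mult_ac)
    also have "\<dots> = complex_of_real r ^ ?d m * ?P m"
      by (simp only: prod.distrib power_sum)
    finally show ?thesis using assms(1) by (simp add: norm_mult norm_power)
  qed
  have abs: "(\<lambda>m. norm (w (?d m) * ?P m)) summable_on multi_idx n"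
  proof (rule Infinite_Sum.abs_summable_on_comparison_test'[OF *])
    fix m
    show "norm (w (?d m) * ?P m) \<le> C * norm (\<Prod>i<n. f i (m i))"
      unfolding f_eq norm_mult using mult_right_mono[OF assms(3)[of "?d m"] norm_ge_zero[of "?P m"]]
      by (simp add: mult_ac)
  qed
  then have summ: "(\<lambda>m. w (?d m) * ?P m) summable_on multi_idx n"
    by (rule abs_summable_summable)
  \<comment> \<open>The multi-indices are the disjoint union of their degree classes; tagging each
    with its degree makes this a Sigma set.\<close>
  let ?S = "SIGMA k:UNIV. {m \<in> multi_idx n. ?d m = k}"
  have inj: "inj_on snd ?S" by (auto simp: inj_on_def)
  have img: "snd ` ?S = multi_idx n" by (auto simp: image_iff)
  have "((\<lambda>m. w (?d m) * ?P m) has_sum (\<Sum>\<^sub>\<infinity>m\<in>multi_idx n. w (?d m) * ?P m)) (snd ` ?S)"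
    unfolding img by (rule has_sum_infsum[OF summ])
  then have hs: "((\<lambda>p. w (?d (snd p)) * ?P (snd p)) has_sum (\<Sum>\<^sub>\<infinity>m\<in>multi_idx n. w (?d m) * ?P m)) ?S"
    unfolding has_sum_reindex[OF inj] by (simp add: o_def)
  show "((\<lambda>k. w k * deg_coeff n b x k) has_sum (\<Sum>\<^sub>\<infinity>m\<in>multi_idx n. w (?d m) * ?P m)) UNIV"
  proof (rule has_sum_Sigma'[OF hs])
    fix k
    have "w k * deg_coeff n b x k = (\<Sum>m\<in>{m \<in> multi_idx n. ?d m = k}. w (?d m) * ?P m)"
      by (simp add: deg_coeff_def sum_distrib_left)
    then show "((\<lambda>m. w (?d (snd (k, m))) * ?P (snd (k, m))) has_sum (w k * deg_coeff n b x k))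
        {m \<in> multi_idx n. ?d m = k}"
      using finite_multi_idx_deg[of n k] by (simp add: has_sum_finite_iff)
  qed
qed

text \<open>For complex families unconditional summability is absolute, so the weight r^k in
  \<open>weighted_multi_sum\<close> already yields the norms.\<close>

lemma summable_deg_coeff:
  assumes "0 \<le> r" "\<And>i. i < n \<Longrightarrow> norm (x i) * r < 1"
  shows "summable (\<lambda>k. norm (deg_coeff n b x k) * r ^ k)"
proof -
  have "(\<lambda>k. complex_of_real r ^ k * deg_coeff n b x k) summable_on UNIV"
    using weighted_multi_sum[where r=r and x=x and n=n and w="\<lambda>k. complex_of_real r ^ k" and C=1 and b=b] assms(2) assms(1)
    by (auto simp: norm_power summable_on_def)
  then have "(\<lambda>k. norm (complex_of_real r ^ k * deg_coeff n b x k)) summable_on UNIV"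
    by (simp add: summable_on_iff_abs_summable_on_complex)
  from summable_on_imp_summable[OF this] show ?thesis
    using assms(1) by (simp add: norm_mult norm_power mult.commute)
qed

lemma prod_powr_sums:
  assumes "0 \<le> t" "\<And>i. i < n \<Longrightarrow> norm (x i) * t < 1"
  shows "(\<lambda>k. deg_coeff n b x k * of_real t ^ k) sums (\<Prod>i<n. (1 - x i * of_real t) powr (- b i))"
proof -
  let ?P = "\<lambda>m. \<Prod>i<n. pochhammer (b i) (m i) * x i ^ m i / fact (m i)"
  have ns: "norm (x i * of_real t) < 1" if "i < n" for i
    using assms(2)[OF that] assms(1) by (simp add: norm_mult)
  have "((\<lambda>m. \<Prod>i<n. pochhammer (b i) (m i) * (x i * of_real t) ^ m i / fact (m i)) has_sum
      (\<Prod>i<n. \<Sum>k. pochhammer (b i) k * (x i * of_real t) ^ k / fact k)) (multi_idx n)"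
    using has_sum_multi_idx_prod(2)[where f="\<lambda>i k. pochhammer (b i) k * (x i * of_real t) ^ k / fact k" and n=n]
      negative_binomial_complex(1) ns by blast
  also have "(\<lambda>m. \<Prod>i<n. pochhammer (b i) (m i) * (x i * of_real t) ^ m i / fact (m i)) =
      (\<lambda>m. complex_of_real t ^ (\<Sum>i<n. m i) * ?P m)"
  proof
    fix m
    have "(\<Prod>i<n. pochhammer (b i) (m i) * (x i * of_real t) ^ m i / fact (m i)) =
      (\<Prod>i<n. complex_of_real t ^ m i * (pochhammer (b i) (m i) * x i ^ m i / fact (m i)))"
      by (simp add: power_mult_distrib mult_ac)
    then show "(\<Prod>i<n. pochhammer (b i) (m i) * (x i * of_real t) ^ m i / fact (m i)) =
      complex_of_real t ^ (\<Sum>i<n. m i) * ?P m" by (simp only: prod.distrib power_sum)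
  qed
  also have "(\<Prod>i<n. \<Sum>k. pochhammer (b i) k * (x i * of_real t) ^ k / fact k)
      = (\<Prod>i<n. (1 - x i * of_real t) powr (- b i))"
    using negative_binomial_complex(2)[OF ns] by (intro prod.cong) (auto simp: sums_iff)
  finally have "infsum (\<lambda>m. complex_of_real t ^ (\<Sum>i<n. m i) * ?P m) (multi_idx n) =
      (\<Prod>i<n. (1 - x i * of_real t) powr (- b i))" by (rule infsumI)
  then show ?thesis
    using has_sum_imp_sums[OF weighted_multi_sum[where r=t and x=x and n=n and w="\<lambda>k. complex_of_real t ^ k" and C=1 and b=b]]
      assms by (simp add: norm_power mult.commute)
qed

text \<open>Since a + j <= c + j factor by factor, the quotient of Pochhammer symbols is at most 1,
  and r = 1 is admissible on the unit polydisc.\<close>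

lemma FD_series_sums:
  assumes "0 < a" "a \<le> c" "\<And>i. i < n \<Longrightarrow> norm (x i) < 1"
  shows "(\<lambda>k. pochhammer (complex_of_real a) k / pochhammer (complex_of_real c) k * deg_coeff n b x k)
     sums FD_series n (of_real a) b (of_real c) x"
proof -
  have le: "norm (pochhammer (complex_of_real a) k / pochhammer (complex_of_real c) k) \<le> 1" for k
  proof -
    have "pochhammer a k \<le> pochhammer c k"
      unfolding pochhammer_prod using assms by (intro prod_mono) auto
    moreover have "pochhammer a k > 0" "pochhammer c k > 0"
      using assms by (auto intro: pochhammer_pos)
    ultimately show ?thesis
      by (simp add: pochhammer_of_real norm_divide)
  qed
  have "FD_series n (of_real a) b (of_real c) x = (\<Sum>\<^sub>\<infinity>m\<in>multi_idx n.
     pochhammer (of_real a) (\<Sum>i<n. m i) / pochhammer (of_real c) (\<Sum>i<n. m i)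
       * (\<Prod>i<n. pochhammer (b i) (m i) * x i ^ m i / fact (m i)))"
    unfolding FD_series_def by (intro infsum_cong) (simp add: prod.distrib prod_dividef)
  then show ?thesis
    using has_sum_imp_sums[OF weighted_multi_sum[where r=1 and x=x and b=b and n=n and C=1 and
      w="\<lambda>k. pochhammer (of_real a) k / pochhammer (of_real c) k"]] assms le by simp
qed

text \<open>From c >= 1 follows (c)_k >= k!, so the weight t^k / (c)_k decays faster than any
  geometric sequence and the x_i may be arbitrary. The constant exp(|t| D) bounds each single term
  of its own exponential series.\<close>

lemma Phi2_sums:
  assumes "c \<ge> 1"
  shows "(\<lambda>k. deg_coeff n b x k * of_real t ^ k / pochhammer (complex_of_real c) k)
     sums Phi2 n b (of_real c) (\<lambda>i. x i * complex_of_real t)"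
proof -
  \<comment> \<open>D exceeds every |x_i|, so r = 1 / D meets the radius condition.\<close>
  define D where "D = 1 + (\<Sum>i<n. norm (x i))"
  have D: "D \<ge> 1" unfolding D_def by (simp add: sum_nonneg)
  have xD: "norm (x i) * (1 / D) < 1" if "i < n" for i
  proof -
    have "norm (x i) < D"
      unfolding D_def using member_le_sum[of i "{..<n}" "\<lambda>i. norm (x i)"] that by simp
    then show ?thesis using D by simp
  qed
  have le: "norm (complex_of_real t ^ k / pochhammer (complex_of_real c) k) \<le> exp (\<bar>t\<bar> * D) * (1 / D) ^ k" for k
  proof -
    have "pochhammer 1 k \<le> pochhammer c k"
      unfolding pochhammer_prod using assms by (intro prod_mono) auto
    then have f: "fact k \<le> pochhammer c k" by (simp add: pochhammer_fact)
    have fp: "(0::real) < fact k" by simp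
    have ex: "(\<bar>t\<bar> * D) ^ k / fact k \<le> exp (\<bar>t\<bar> * D)"
    proof -
      have "(\<lambda>k. (\<bar>t\<bar> * D) ^ k / fact k) sums exp (\<bar>t\<bar> * D)"
        using exp_converges[of "\<bar>t\<bar> * D"] by (simp add: divide_inverse mult.commute)
      then show ?thesis using D sum_le_suminf[of "\<lambda>k. (\<bar>t\<bar> * D) ^ k / fact k" "{k}"] by (simp add: sums_iff)
    qed
    have "norm (complex_of_real t ^ k / pochhammer (complex_of_real c) k) = \<bar>t\<bar> ^ k / pochhammer c k"
      using f fp by (simp add: pochhammer_of_real norm_divide norm_power del: fact_gt_zero)
    also have "\<dots> \<le> \<bar>t\<bar> ^ k / fact k"
      using f fp less_le_trans[OF fp f] by (intro divide_left_mono mult_pos_pos) auto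
    also have "\<dots> = (\<bar>t\<bar> * D) ^ k / fact k * (1 / D) ^ k"
      using D by (simp add: power_mult_distrib field_simps)
    also have "\<dots> \<le> exp (\<bar>t\<bar> * D) * (1 / D) ^ k"
      using ex D by (intro mult_right_mono) auto
    finally show ?thesis .
  qed
  have "Phi2 n b (of_real c) (\<lambda>i. x i * complex_of_real t) = (\<Sum>\<^sub>\<infinity>m\<in>multi_idx n.
     (of_real t ^ (\<Sum>i<n. m i)) / pochhammer (of_real c) (\<Sum>i<n. m i)
       * (\<Prod>i<n. pochhammer (b i) (m i) * x i ^ m i / fact (m i)))"
    unfolding Phi2_def
    by (intro infsum_cong) (simp add: prod.distrib prod_dividef power_mult_distrib power_sum)
  moreover have "0 \<le> 1 / D" using D by simp
  from has_sum_imp_sums[OF weighted_multi_sum[where b=b and x=x and n=n, OF this xD le]]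
  have "(\<lambda>k. of_real t ^ k / pochhammer (of_real c) k * deg_coeff n b x k) sums
    (\<Sum>\<^sub>\<infinity>m\<in>multi_idx n. (of_real t ^ (\<Sum>i<n. m i)) / pochhammer (of_real c) (\<Sum>i<n. m i)
       * (\<Prod>i<n. pochhammer (b i) (m i) * x i ^ m i / fact (m i)))" by simp
  ultimately show ?thesis by (simp add: mult.commute)
qed

section \<open>Laplace transform of the confluent Lauricella function\<close>

text \<open>Both arguments lie in (-pi/2, pi/2), so their sum stays inside (-pi, pi) and the
  principal logarithm is additive.\<close>

lemma powr_mult_Re_pos:
  fixes w z c :: complex
  assumes "Re w > 0" "Re z > 0"
  shows "(w * z) powr c = w powr c * z powr c"
proof -
  have nz: "w \<noteq> 0" "z \<noteq> 0" using assms by auto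
  have "\<bar>Im (Ln w)\<bar> < pi / 2" "\<bar>Im (Ln z)\<bar> < pi / 2"
    using assms nz Re_Ln_pos_lt by auto
  then have "Ln (w * z) = Ln w + Ln z"
    using nz by (intro Ln_times_simple) auto
  then show ?thesis using nz by (simp add: powr_def exp_add ring_distribs)
qed

text \<open>Take powers of the identity a (1 + r/a) = r (1 + a/r), in which all four factors lie in
  the right half plane. This replaces r/a by a/r, which is small for large r.\<close>

lemma powr_one_plus_inverse:
  fixes a b :: complex and r :: real
  assumes "Re a > 0" "r > 0"
  shows "(1 + of_real r / a) powr (- b) =
    a powr b * of_real r powr (- b) * (1 + a / of_real r) powr (- b)"
proof -
  have a: "a \<noteq> 0" using assms by auto
  have "Re (of_real r / a) > 0"
    using assms a by (simp add: Re_divide sum_power2_gt_zero_iff complex_eq_iff)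
  then have "(a * (1 + of_real r / a)) powr (- b) = a powr (- b) * (1 + of_real r / a) powr (- b)"
    using assms by (intro powr_mult_Re_pos) (auto intro!: add_pos_pos)
  moreover have "(of_real r * (1 + a / of_real r)) powr (- b) = of_real r powr (- b) * (1 + a / of_real r) powr (- b)"
    using assms by (intro powr_mult_Re_pos) (auto intro!: add_pos_pos)
  moreover have "a * (1 + of_real r / a) = of_real r * (1 + a / of_real r)"
    using a assms by (simp add: field_simps)
  ultimately have "a powr (- b) * (1 + of_real r / a) powr (- b) = of_real r powr (- b) * (1 + a / of_real r) powr (- b)"
    by simp
  then have "a powr b * a powr (- b) * (1 + of_real r / a) powr (- b) =
    a powr b * of_real r powr (- b) * (1 + a / of_real r) powr (- b)"
    by (metis mult.assoc)
  moreover have "a powr b * a powr (- b) = 1" using a by (simp add: powr_minus)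
  ultimately show ?thesis by simp
qed

text \<open>The factors r^(-b_i) multiply to r raised to minus the sum of the b_i, a real power
  because that sum is real.\<close>

lemma prod_powr_one_plus_inverse:
  fixes a b :: "nat \<Rightarrow> complex"
  assumes "\<And>i. i < n \<Longrightarrow> Re (a i) > 0" "r > 0" "(\<Sum>i<n. b i) = of_real B"
  shows "(\<Prod>i<n. (1 + of_real r / a i) powr (- b i)) =
    (\<Prod>i<n. a i powr b i) * of_real (r powr (- B)) * (\<Prod>i<n. (1 + a i / of_real r) powr (- b i))"
proof -
  have "(\<Prod>i<n. (1 + of_real r / a i) powr (- b i)) =
      (\<Prod>i<n. a i powr b i * of_real r powr (- b i) * (1 + a i / of_real r) powr (- b i))"
    using assms by (intro prod.cong powr_one_plus_inverse) auto
  also have "\<dots> = (\<Prod>i<n. a i powr b i) * (\<Prod>i<n. of_real r powr (- b i))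
      * (\<Prod>i<n. (1 + a i / of_real r) powr (- b i))"
    by (simp add: prod.distrib)
  also have "(\<Prod>i<n. of_real r powr (- b i)) = complex_of_real r powr (\<Sum>i<n. - b i)"
    using assms(2) by (subst powr_sum) auto
  also have "\<dots> = of_real (r powr (- B))"
    using assms by (simp add: sum_negf powr_of_real flip: of_real_minus)
  finally show ?thesis .
qed

text \<open>Euler's integral for Gamma after the scaling t -> u t; the factor u^(1 - s) undoes the
  scaling inside the power.\<close>

lemma has_bochner_integral_laplace_powr:
  fixes u s :: real
  assumes "u > 0" "s > 0"
  shows "has_bochner_integral lborel (\<lambda>t. indicator {0..} t * (exp (- u * t) * t powr (s - 1)))
    (Gamma s / u powr s)"
proof -
  have "has_bochner_integral lborel (\<lambda>t. indicator {0..} t * t powr (s - 1) / exp t) (Gamma s)"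
    using Gamma_conv_nn_integral_real[OF assms(2)] assms(2)
    by (intro has_bochner_integral_nn_integral) (auto intro: Gamma_real_nonneg)
  then have "has_bochner_integral lborel
      (\<lambda>t. indicator {0..} (0 + u * t) * (0 + u * t) powr (s - 1) / exp (0 + u * t)) (Gamma s /\<^sub>R \<bar>u\<bar>)"
    using assms(1) by (subst (asm) lborel_has_bochner_integral_real_affine_iff[of u _ _ 0]) auto
  from has_bochner_integral_mult_right[OF this, of "u powr (1 - s)"]
  have "has_bochner_integral lborel
      (\<lambda>t. u powr (1 - s) * (indicator {0..} (0 + u * t) * (0 + u * t) powr (s - 1) / exp (0 + u * t)))
      (u powr (1 - s) * (Gamma s /\<^sub>R \<bar>u\<bar>))" by simp
  also have "(\<lambda>t. u powr (1 - s) * (indicator {0..} (0 + u * t) * (0 + u * t) powr (s - 1) / exp (0 + u * t)))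
      = (\<lambda>t. indicator {0..} t * (exp (- u * t) * t powr (s - 1)))"
  proof
    fix t :: real
    have "u powr (1 - s) * (u powr (s - 1)) = 1" using assms by (simp flip: powr_add)
    then have "u powr (1 - s) * (u * t) powr (s - 1) = t powr (s - 1)" if "t \<ge> 0"
      using that assms by (simp add: powr_mult flip: mult.assoc)
    then show "u powr (1 - s) * (indicator {0..} (0 + u * t) * (0 + u * t) powr (s - 1) / exp (0 + u * t))
      = indicator {0..} t * (exp (- u * t) * t powr (s - 1))"
      using assms by (auto simp: indicator_def zero_le_mult_iff exp_minus field_simps)
  qed
  also have "u powr (1 - s) * (Gamma s /\<^sub>R \<bar>u\<bar>) = Gamma s / u powr s"
    using assms by (simp add: powr_diff field_simps)
  finally show ?thesis .
qed

text \<open>The k-th term contains t^(B + k), whose transform Gamma(c + k) / u^(c + k) cancels (c)_k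
  up to Gamma(c). What remains is the power series of the product at 1/u, inside its disc because
  |x_i| < u.\<close>

lemma laplace_Phi2:
  fixes u B :: real and x b :: "nat \<Rightarrow> complex"
  assumes "u > 0" "B \<ge> 0" "\<And>i. i < n \<Longrightarrow> norm (x i) < u"
  shows "has_bochner_integral lborel
      (\<lambda>t. indicator {0..} t *\<^sub>R (of_real (exp (- u * t) * t powr B) *
         Phi2 n b (of_real (1 + B)) (\<lambda>i. x i * of_real t)))
      (of_real (Gamma (1 + B) * u powr (- (1 + B))) * (\<Prod>i<n. (1 - x i / of_real u) powr (- b i)))"
proof -
  let ?d = "deg_coeff n b x"
  define c where "c = 1 + B"
  have c: "c \<ge> 1" using assms c_def by auto
  have pc: "pochhammer c k = Gamma (c + real k) / Gamma c" for k
    using c by (intro pochhammer_Gamma) auto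
  have Gp: "Gamma (c + real k) > 0" for k using c by (intro Gamma_real_pos) auto
  define g where "g k t = indicator {0..} t * (exp (- u * t) * t powr ((c + real k) - 1))" for k and t :: real
  define e where "e k = ?d k / of_real (pochhammer c k)" for k
  have g: "has_bochner_integral lborel (g k) (Gamma (c + real k) / u powr (c + real k))" for k
    unfolding g_def using c assms by (intro has_bochner_integral_laplace_powr) auto
  have gnn: "g k t \<ge> 0" for k t by (auto simp: g_def)
  have gint: "integrable lborel (g k)" for k using g by (simp add: has_bochner_integral_iff)
  have gval: "integral\<^sup>L lborel (g k) = Gamma (c + real k) / u powr (c + real k)" for k
    using g by (rule has_bochner_integral_integral_eq)
  have eg: "e k * of_real (Gamma (c + real k) / u powr (c + real k)) =
      of_real (Gamma c * u powr (- c)) * (?d k * of_real (1 / u) ^ k)" for k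
  proof -
    have "u powr (c + real k) = u powr c * u ^ k" using assms by (simp add: powr_add powr_realpow)
    moreover have "Gamma c > 0" using c by (intro Gamma_real_pos) auto
    ultimately show ?thesis using Gp[of k] assms unfolding e_def pc
      by (simp add: powr_minus field_simps)
  qed
  define f where "f k t = e k * of_real (g k t)" for k t
  have f_eq: "f k t = (indicator {0..} t *\<^sub>R of_real (exp (- u * t) * t powr B)) * (?d k * of_real t ^ k / pochhammer (of_real c) k)"
    for k t
  proof (cases "t > 0")
    case True
    then have "t powr (c + real k - 1) = t powr B * t ^ k"
      by (simp add: c_def powr_add powr_realpow)
    then show ?thesis using True by (simp add: f_def g_def e_def pochhammer_of_real)
  next
    case False
    \<comment> \<open>At t = 0 both sides vanish, because \<open>0 powr s\<close> is 0 for every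
      exponent.\<close>
    have "0 ^ k * t powr B = t powr (c + real k - 1)" if "t = 0"
      using assms that by (auto simp: c_def)
    then show ?thesis using False
      by (auto simp: f_def g_def indicator_def c_def)
  qed
  have fint: "integrable lborel (f k)" for k
    unfolding f_def by (intro integrable_mult_right integrable_of_real gint)
  have fval: "integral\<^sup>L lborel (f k) = of_real (Gamma c * u powr (- c)) * (?d k * of_real (1 / u) ^ k)" for k
    unfolding f_def using eg[of k] gval[of k] by simp
  \<comment> \<open>As \<open>g k\<close> is nonnegative, taking norms only replaces the coefficient
    by its modulus; the termwise norms again form a power series at 1/u.\<close>
  have fnval: "integral\<^sup>L lborel (\<lambda>t. norm (f k t)) = Gamma c * u powr (- c) * (norm (?d k) * (1 / u) ^ k)" for k
  proof -
    have "integral\<^sup>L lborel (\<lambda>t. norm (f k t)) = norm (e k) * integral\<^sup>L lborel (g k)"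
      unfolding f_def using gnn by (simp add: norm_mult)
    also have "\<dots> = norm (e k * of_real (Gamma (c + real k) / u powr (c + real k)))"
      unfolding gval norm_mult norm_of_real using Gp[of k] by simp
    also have "\<dots> = Gamma c * u powr (- c) * (norm (?d k) * (1 / u) ^ k)"
      unfolding eg using Gp[of 0] assms by (simp add: norm_mult norm_divide norm_power)
    finally show ?thesis .
  qed
  have xu: "norm (x i) * (1 / u) < 1" if "i < n" for i using assms(1) assms(3)[OF that] by simp
  have fs: "(\<lambda>k. f k t) sums ((indicator {0..} t *\<^sub>R of_real (exp (- u * t) * t powr B)) *
      Phi2 n b (of_real c) (\<lambda>i. x i * of_real t))" for t
    unfolding f_eq by (rule sums_mult[OF Phi2_sums[OF c]])
  have fsn: "summable (\<lambda>k. norm (f k t))" for t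
  proof -
    have "summable (\<lambda>k. norm (?d k * of_real t ^ k / pochhammer (complex_of_real c) k))"
    proof -
      \<comment> \<open>Convergence at the larger point |t| + 1 gives absolute convergence at
        t.\<close>
      have "summable (\<lambda>k. (?d k / pochhammer (complex_of_real c) k) * of_real (\<bar>t\<bar> + 1) ^ k)"
        using sums_summable[OF Phi2_sums[OF c, of n b x "\<bar>t\<bar> + 1"]] by simp
      from powser_insidea[OF this, of "of_real t"] show ?thesis by simp
    qed
    then show ?thesis unfolding f_eq norm_mult by (rule summable_mult)
  qed
  have sumint: "summable (\<lambda>k. integral\<^sup>L lborel (\<lambda>t. norm (f k t)))"
    unfolding fnval using summable_deg_coeff[of "1/u" n x b] xu assms(1) by (intro summable_mult) auto
  have "integrable lborel (\<lambda>t. \<Sum>k. f k t)"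
    by (intro integrable_suminf fint AE_I2 fsn sumint)
  moreover have "(\<lambda>k. integral\<^sup>L lborel (f k)) sums (integral\<^sup>L lborel (\<lambda>t. \<Sum>k. f k t))"
    by (intro sums_integral fint AE_I2 fsn sumint)
  moreover have "(\<lambda>k. integral\<^sup>L lborel (f k)) sums
     (of_real (Gamma c * u powr (- c)) * (\<Prod>i<n. (1 - x i * of_real (1 / u)) powr (- b i)))"
    unfolding fval by (intro sums_mult prod_powr_sums xu) (use assms in auto)
  ultimately have "has_bochner_integral lborel (\<lambda>t. \<Sum>k. f k t)
    (of_real (Gamma c * u powr (- c)) * (\<Prod>i<n. (1 - x i * of_real (1 / u)) powr (- b i)))"
    unfolding has_bochner_integral_iff using sums_unique2 by blast
  moreover have "(\<lambda>t. \<Sum>k. f k t) = (\<lambda>t. indicator {0..} t *\<^sub>R (of_real (exp (- u * t) * t powr B) *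
         Phi2 n b (of_real (1 + B)) (\<lambda>i. x i * of_real t)))"
    (is "_ = ?F")
  proof
    fix t
    show "(\<Sum>k. f k t) = ?F t" using sums_unique[OF fs[of t]] by (simp add: c_def)
  qed
  moreover have "x i * of_real (1 / u) = x i / of_real u" for i by simp
  ultimately show ?thesis by (simp only: c_def)
qed

section \<open>Uniqueness of Laplace transforms and the distribution function\<close>

text \<open>The functions y^j (1 - y)^m are the Bernstein basis up to constants. The induction uses
  y^j (1 - y)^(m+1) = y^j (1 - y)^m - y^(j+1) (1 - y)^m, so j must stay arbitrary.\<close>

lemma laplace_weight_polynomial:
  fixes w :: "real \<Rightarrow> real"
  assumes "\<And>k::nat. has_bochner_integral lborel (\<lambda>t. w t * exp (- t) ^ k) 0"
  shows "has_bochner_integral lborel (\<lambda>t. w t * (exp (- t) ^ j * (1 - exp (- t)) ^ m)) 0"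
proof (induction m arbitrary: j)
  case 0
  then show ?case using assms[of j] by simp
next
  case (Suc m)
  from has_bochner_integral_diff[OF Suc.IH[of j] Suc.IH[of "Suc j"]]
  show ?case by (simp add: algebra_simps)
qed

text \<open>For t >= 0 the point exp(-t) lies in [0, 1], where Bernstein polynomials approximate
  \<open>\<phi>\<close> uniformly within e. Their integrals against w vanish, so the integral is at
  most e times the L1 norm W of w.\<close>

lemma laplace_weight_continuous:
  fixes w \<phi> :: "real \<Rightarrow> real"
  assumes moments: "\<And>k::nat. has_bochner_integral lborel (\<lambda>t. w t * exp (- t) ^ k) 0"
    and w0: "\<And>t. t < 0 \<Longrightarrow> w t = 0"
    and cont: "continuous_on UNIV \<phi>"
  shows "has_bochner_integral lborel (\<lambda>t. w t * \<phi> (exp (- t))) 0"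
proof -
  have w_int: "integrable lborel w"
    using moments[of 0] by (simp add: has_bochner_integral_iff)
  then have [measurable]: "w \<in> borel_measurable borel" by auto
  have [measurable]: "\<phi> \<in> borel_measurable borel"
    using cont by (rule borel_measurable_continuous_onI)
  have c01: "continuous_on {0..1} \<phi>" using cont continuous_on_subset by blast
  then obtain K where K: "\<And>y. y \<in> {0..1} \<Longrightarrow> \<bar>\<phi> y\<bar> \<le> K"
    using compact_imp_bounded[OF compact_continuous_image[OF c01 compact_Icc]]
    unfolding bounded_iff by (metis image_eqI real_norm_def)
  have int: "integrable lborel (\<lambda>t. w t * \<phi> (exp (- t)))"
  proof (rule Bochner_Integration.integrable_bound[where f="\<lambda>t. K * w t"])
    show "AE t in lborel. norm (w t * \<phi> (exp (- t))) \<le> norm (K * w t)"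
    proof (rule AE_I2)
      fix t :: real
      show "norm (w t * \<phi> (exp (- t))) \<le> norm (K * w t)"
      proof (cases "t < 0")
        case False
        then have "\<bar>\<phi> (exp (- t))\<bar> \<le> K" by (intro K) auto
        then have "\<bar>w t\<bar> * \<bar>\<phi> (exp (- t))\<bar> \<le> \<bar>w t\<bar> * \<bar>K\<bar>" by (intro mult_left_mono) auto
        then show ?thesis by (simp add: abs_mult mult.commute)
      qed (simp add: w0)
    qed
  qed (use w_int in auto)
  define I where "I = integral\<^sup>L lborel (\<lambda>t. w t * \<phi> (exp (- t)))"
  define W where "W = integral\<^sup>L lborel (\<lambda>t. \<bar>w t\<bar>)"
  have W: "W \<ge> 0" unfolding W_def by simp
  have bound: "\<bar>I\<bar> \<le> e * W" if e: "e > 0" for e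
  proof -
    obtain N where N: "\<And>x. x \<in> {0..1} \<Longrightarrow> \<bar>\<phi> x - (\<Sum>k\<le>N. \<phi> (k / N) * Bernstein N k x)\<bar> < e"
      using Bernstein_Weierstrass[OF c01 e] by blast
    define p where "p x = (\<Sum>k\<le>N. \<phi> (k / N) * Bernstein N k x)" for x
    have p: "\<bar>\<phi> x - p x\<bar> < e" if "x \<in> {0..1}" for x
      using N[OF that] by (simp only: p_def)
    have "has_bochner_integral lborel (\<lambda>t. \<Sum>k\<le>N. (\<phi> (k / N) * (N choose k)) *
        (w t * (exp (- t) ^ k * (1 - exp (- t)) ^ (N - k)))) (\<Sum>k\<le>N. (\<phi> (k / N) * (N choose k)) * 0)"
      by (intro has_bochner_integral_sum has_bochner_integral_mult_right laplace_weight_polynomial moments)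
    moreover have "(\<lambda>t. \<Sum>k\<le>N. (\<phi> (k / N) * (N choose k)) *
        (w t * (exp (- t) ^ k * (1 - exp (- t)) ^ (N - k)))) = (\<lambda>t. w t * p (exp (- t)))"
      by (simp add: p_def Bernstein_def sum_distrib_left mult_ac)
    ultimately have P: "has_bochner_integral lborel (\<lambda>t. w t * p (exp (- t))) 0" by simp
    then have Pi: "integrable lborel (\<lambda>t. w t * p (exp (- t)))"
      and P0: "integral\<^sup>L lborel (\<lambda>t. w t * p (exp (- t))) = 0"
      unfolding has_bochner_integral_iff by blast+
    have I: "I = integral\<^sup>L lborel (\<lambda>t. w t * \<phi> (exp (- t)) - w t * p (exp (- t)))"
      using Bochner_Integration.integral_diff[OF int Pi] unfolding P0 I_def diff_zero by (rule sym)
    have "\<bar>I\<bar> \<le> integral\<^sup>L lborel (\<lambda>t. \<bar>w t * \<phi> (exp (- t)) - w t * p (exp (- t))\<bar>)"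
      unfolding I by (rule integral_abs_bound)
    also have "\<dots> \<le> integral\<^sup>L lborel (\<lambda>t. e * \<bar>w t\<bar>)"
    proof (rule integral_mono)
      show "integrable lborel (\<lambda>t. \<bar>w t * \<phi> (exp (- t)) - w t * p (exp (- t))\<bar>)"
        by (intro integrable_abs Bochner_Integration.integrable_diff int Pi)
      show "integrable lborel (\<lambda>t. e * \<bar>w t\<bar>)"
        by (intro integrable_mult_right integrable_abs w_int)
      fix t :: real
      show "\<bar>w t * \<phi> (exp (- t)) - w t * p (exp (- t))\<bar> \<le> e * \<bar>w t\<bar>"
      proof (cases "t < 0")
        case False
        then have "\<bar>\<phi> (exp (- t)) - p (exp (- t))\<bar> \<le> e" by (intro less_imp_le p) auto
        then have "\<bar>w t\<bar> * \<bar>\<phi> (exp (- t)) - p (exp (- t))\<bar> \<le> \<bar>w t\<bar> * e" by (rule mult_left_mono) simp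
        then show ?thesis
          unfolding abs_mult[symmetric] right_diff_distrib by (simp only: mult.commute[of e])
      next
        case True
        show ?thesis unfolding w0[OF True] by simp
      qed
    qed
    also have "\<dots> = e * W" by (simp add: W_def)
    finally show ?thesis .
  qed
  have "\<bar>I\<bar> \<le> 0"
  proof (rule field_le_epsilon)
    fix e :: real assume "e > 0"
    \<comment> \<open>Dividing by W + 1 rather than W covers the case W = 0.\<close>
    then have "\<bar>I\<bar> \<le> e / (W + 1) * W" using W by (intro bound) auto
    also have "\<dots> \<le> e" using W \<open>e > 0\<close> by (simp add: field_simps)
    finally show "\<bar>I\<bar> \<le> 0 + e" by simp
  qed
  then show ?thesis using int by (simp add: has_bochner_integral_iff I_def)
qed

text \<open>Right continuity spreads positivity of h at t0 to an interval (t0, t1). Testing against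
  a bump supported there gives a nonnegative integrand with integral 0, hence an interval of
  positive length and measure zero.\<close>

lemma laplace_zero_not_pos:
  fixes h :: "real \<Rightarrow> real"
  assumes lap: "\<And>k::nat. has_bochner_integral lborel (\<lambda>t. indicator {0..} t * (exp (- (u + real k) * t) * h t)) 0"
    and "t0 \<ge> 0" and rc: "continuous (at_right t0) h"
  shows "\<not> h t0 > 0"
proof
  assume pos: "h t0 > 0"
  have "eventually (\<lambda>t. h t > 0) (at_right t0)"
    using rc pos by (intro order_tendstoD(1)) (auto simp: continuous_within)
  then obtain t1 where t1: "t1 > t0" "\<And>t. t0 < t \<Longrightarrow> t < t1 \<Longrightarrow> h t > 0"
    unfolding eventually_at_right_field by auto
  \<comment> \<open>Absorbing exp(-u t) into the weight turns the transforms at u + k into moments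
    of exp(-t).\<close>
  define w where "w t = indicator {0..} t * (exp (- u * t) * h t)" for t
  \<comment> \<open>The quadratic is positive exactly for exp(-t1) < y < exp(-t0), that is for t0 <
    t < t1; cutting it off at 0 keeps it continuous.\<close>
  define \<phi> where "\<phi> y = max 0 ((y - exp (- t1)) * (exp (- t0) - y))" for y :: real
  have "has_bochner_integral lborel (\<lambda>t. w t * exp (- t) ^ k) 0" for k :: nat
  proof -
    have "w t * exp (- t) ^ k = indicator {0..} t * (exp (- (u + real k) * t) * h t)" for t
      by (simp add: w_def algebra_simps exp_diff exp_minus exp_of_nat_mult field_simps flip: exp_of_nat_mult exp_add)
    then show ?thesis using lap[of k] by simp
  qed
  then have I: "has_bochner_integral lborel (\<lambda>t. w t * \<phi> (exp (- t))) 0"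
    by (rule laplace_weight_continuous)
      (auto simp: w_def \<phi>_def intro!: continuous_intros)
  have \<phi>0: "\<phi> (exp (- t)) = 0" if "\<not> (t0 < t \<and> t < t1)" for t
  proof -
    have "(exp (- t) - exp (- t1)) * (exp (- t0) - exp (- t)) \<le> 0"
      using that t1(1) by (cases "t \<le> t0") (auto intro: mult_nonneg_nonpos mult_nonpos_nonneg)
    then show ?thesis by (simp add: \<phi>_def)
  qed
  have \<phi>1: "\<phi> (exp (- t)) > 0" if "t0 < t" "t < t1" for t
    using that by (auto simp: \<phi>_def less_max_iff_disj)
  have nn: "w t * \<phi> (exp (- t)) \<ge> 0" for t
  proof (cases "t0 < t \<and> t < t1")
    case True
    then show ?thesis using \<phi>1[of t] t1(2)[of t] by (auto simp: w_def)
  qed (simp add: \<phi>0)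
  from I have "AE t in lborel. w t * \<phi> (exp (- t)) = 0"
    using integral_nonneg_eq_0_iff_AE[of lborel "\<lambda>t. w t * \<phi> (exp (- t))"] nn
    by (simp add: has_bochner_integral_iff)
  then have "AE t in lborel. t \<notin> {t0<..<t1}"
  proof (rule AE_mp, intro AE_I2 impI notI)
    fix t assume "w t * \<phi> (exp (- t)) = 0" "t \<in> {t0<..<t1}"
    then show False using \<phi>1[of t] t1(2)[of t] assms(2) by (auto simp: w_def)
  qed
  then have "emeasure lborel {t0<..<t1} = 0"
    by (subst (asm) AE_iff_measurable[of "{t0<..<t1}"]) auto
  then show False using t1(1) by simp
qed

lemma laplace_zero:
  fixes h :: "real \<Rightarrow> complex"
  assumes lap: "\<And>k::nat. has_bochner_integral lborel (\<lambda>t. indicator {0..} t *\<^sub>R (of_real (exp (- (u + real k) * t)) * h t)) 0"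
    and "t0 \<ge> 0" and rc: "continuous (at_right t0) h"
  shows "h t0 = 0"
proof -
  have R: "has_bochner_integral lborel (\<lambda>t. indicator {0..} t * (exp (- (u + real k) * t) * Re (h t))) 0" for k
    using has_bochner_integral_bounded_linear[OF bounded_linear_Re lap[of k]] by simp
  have I: "has_bochner_integral lborel (\<lambda>t. indicator {0..} t * (exp (- (u + real k) * t) * Im (h t))) 0" for k
    using has_bochner_integral_bounded_linear[OF bounded_linear_Im lap[of k]] by simp
  have R': "has_bochner_integral lborel (\<lambda>t. indicator {0..} t * (exp (- (u + real k) * t) * - Re (h t))) 0" for k
    using has_bochner_integral_minus[OF R[of k]] by simp
  have I': "has_bochner_integral lborel (\<lambda>t. indicator {0..} t * (exp (- (u + real k) * t) * - Im (h t))) 0" for k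
    using has_bochner_integral_minus[OF I[of k]] by simp
  have cR: "continuous (at_right t0) (\<lambda>t. Re (h t))" and cI: "continuous (at_right t0) (\<lambda>t. Im (h t))"
    using rc by (rule continuous_Re, rule continuous_Im)
  have "\<not> Re (h t0) > 0" "\<not> - Re (h t0) > 0" "\<not> Im (h t0) > 0" "\<not> - Im (h t0) > 0"
    by (rule laplace_zero_not_pos[OF R assms(2) cR] laplace_zero_not_pos[OF I assms(2) cI]
      laplace_zero_not_pos[OF R' assms(2) continuous_minus[OF cR]]
      laplace_zero_not_pos[OF I' assms(2) continuous_minus[OF cI]])+
  then show ?thesis by (simp add: complex_eq_iff)
qed

section \<open>Transform and right continuity of the distribution function\<close>

context prob_space
begin

text \<open>Write F(t) as the expectation of the indicator of X <= t and exchange the integrals: the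
  inner one, of exp(-u t) over t >= X, equals exp(-u X) / u.\<close>

lemma laplace_cdf:
  fixes X :: "'a \<Rightarrow> real"
  assumes [measurable]: "X \<in> borel_measurable M"
    and nn: "\<And>\<omega>. \<omega> \<in> space M \<Longrightarrow> X \<omega> \<ge> 0" and u: "u > 0"
  shows "has_bochner_integral lborel (\<lambda>t. indicator {0..} t * (exp (- u * t) * measure M {\<omega>\<in>space M. X \<omega> \<le> t}))
    (expectation (\<lambda>\<omega>. exp (- u * X \<omega>)) / u)"
proof (rule has_bochner_integral_nn_integral)
  have mono: "mono (\<lambda>t. measure M {\<omega>\<in>space M. X \<omega> \<le> t})"
    by (intro monoI finite_measure_mono) auto
  then have [measurable]: "(\<lambda>t. measure M {\<omega>\<in>space M. X \<omega> \<le> t}) \<in> borel_measurable borel"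
    by (rule borel_measurable_mono)
  show "(\<lambda>t. indicator {0..} t * (exp (- u * t) * measure M {\<omega>\<in>space M. X \<omega> \<le> t})) \<in> borel_measurable lborel"
    by simp
  interpret P: pair_sigma_finite lborel M ..
  have "(\<integral>\<^sup>+ t. ennreal (indicator {0..} t * (exp (- u * t) * measure M {\<omega>\<in>space M. X \<omega> \<le> t})) \<partial>lborel)
     = (\<integral>\<^sup>+ t. \<integral>\<^sup>+ \<omega>. ennreal (exp (- u * t)) * indicator {X \<omega>..} t \<partial>M \<partial>lborel)"
  proof (intro nn_integral_cong)
    fix t :: real
    have "(\<integral>\<^sup>+ \<omega>. ennreal (exp (- u * t)) * indicator {X \<omega>..} t \<partial>M)
        = (\<integral>\<^sup>+ \<omega>. ennreal (exp (- u * t)) * indicator {\<omega>\<in>space M. X \<omega> \<le> t} \<omega> \<partial>M)"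
      by (intro nn_integral_cong) (auto simp: indicator_def)
    also have "\<dots> = ennreal (exp (- u * t) * measure M {\<omega>\<in>space M. X \<omega> \<le> t})"
      by (subst nn_integral_cmult_indicator) (auto simp: emeasure_eq_measure ennreal_mult)
    also have "\<dots> = ennreal (indicator {0..} t * (exp (- u * t) * measure M {\<omega>\<in>space M. X \<omega> \<le> t}))"
    \<comment> \<open>For negative t the event X <= t is empty, so restricting to t >= 0 loses
      nothing.\<close>
    proof (cases "t \<ge> 0")
      case False
      then have *: "{\<omega>\<in>space M. X \<omega> \<le> t} = {}" using nn by force
      show ?thesis unfolding * by simp
    qed simp
    finally show "ennreal (indicator {0..} t * (exp (- u * t) * measure M {\<omega>\<in>space M. X \<omega> \<le> t})) =
      (\<integral>\<^sup>+ \<omega>. ennreal (exp (- u * t)) * indicator {X \<omega>..} t \<partial>M)" ..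
  qed
  also have "\<dots> = (\<integral>\<^sup>+ \<omega>. \<integral>\<^sup>+ t. ennreal (exp (- u * t)) * indicator {X \<omega>..} t \<partial>lborel \<partial>M)"
    by (rule P.Fubini'[symmetric]) (simp add: atLeast_def indicator_def[abs_def])
  also have "\<dots> = (\<integral>\<^sup>+ \<omega>. ennreal (exp (- u * X \<omega>) / u) \<partial>M)"
  proof (intro nn_integral_cong)
    fix \<omega>
    have der: "((\<lambda>t. - exp (- u * t) / u) has_real_derivative exp (- u * t)) (at t)" for t
    proof -
      have "((\<lambda>t. exp (- u * t)) has_real_derivative exp (- u * t) * - u) (at t)"
        by (rule derivative_eq_intros refl | simp)+
      from DERIV_cdivide[OF DERIV_minus[OF this], of u] show ?thesis using u by simp
    qed
    have "((\<lambda>t. - exp (- u * t) / u) \<longlongrightarrow> - 0 / u) at_top"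
      using u by (intro tendsto_intros) (real_asymp, simp)
    then have "(\<integral>\<^sup>+ t. ennreal (exp (- u * t)) * indicator {X \<omega>..} t \<partial>lborel) = ennreal (- 0 / u - (- exp (- u * X \<omega>) / u))"
      by (intro nn_integral_FTC_atLeast der) auto
    then show "(\<integral>\<^sup>+ t. ennreal (exp (- u * t)) * indicator {X \<omega>..} t \<partial>lborel) = ennreal (exp (- u * X \<omega>) / u)"
      by simp
  qed
  also have "\<dots> = ennreal (expectation (\<lambda>\<omega>. exp (- u * X \<omega>)) / u)"
  proof -
    have "integrable M (\<lambda>\<omega>. exp (- u * X \<omega>))"
      using nn u by (intro integrable_const_bound[where B=1] AE_I2) auto
    then show ?thesis using u by (subst nn_integral_eq_integral) auto
  qed
  finally show "(\<integral>\<^sup>+ t. ennreal (indicator {0..} t * (exp (- u * t) * measure M {\<omega>\<in>space M. X \<omega> \<le> t})) \<partial>lborel)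
     = ennreal (expectation (\<lambda>\<omega>. exp (- u * X \<omega>)) / u)" .
qed (use u nn in auto)

lemma continuous_at_right_cdf:
  fixes X :: "'a \<Rightarrow> real"
  assumes [measurable]: "X \<in> borel_measurable M"
  shows "continuous (at_right t) (\<lambda>t. measure M {\<omega>\<in>space M. X \<omega> \<le> t})"
proof -
  interpret D: real_distribution "distr M borel X"
    by (simp add: real_distribution_def real_distribution_axioms_def prob_space_distr)
  have "cdf (distr M borel X) = (\<lambda>t. measure M {\<omega>\<in>space M. X \<omega> \<le> t})"
    by (auto simp: cdf_def measure_distr vimage_def Int_def conj_commute intro!: ext)
  then show ?thesis using D.cdf_is_right_cont[of t] by simp
qed

end

text \<open>In t this is a power series that converges at |t| + 1, so t is interior to its disc of
  convergence.\<close>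

lemma continuous_at_right_Phi2:
  assumes "c \<ge> 1"
  shows "continuous (at_right t) (\<lambda>t. Phi2 n b (of_real c) (\<lambda>i. x i * complex_of_real t))"
proof -
  define e where "e k = deg_coeff n b x k / pochhammer (complex_of_real c) k" for k
  have s: "(\<lambda>k. e k * of_real t ^ k) sums Phi2 n b (of_real c) (\<lambda>i. x i * complex_of_real t)" for t
    using Phi2_sums[OF assms, of n b x t] by (simp add: e_def)
  then have eq: "(\<lambda>t. Phi2 n b (of_real c) (\<lambda>i. x i * complex_of_real t)) = (\<lambda>t. (\<lambda>z. \<Sum>k. e k * z ^ k) (of_real t))"
    by (auto simp: sums_iff)
  have pw: "isCont (\<lambda>z. \<Sum>k. e k * z ^ k) (complex_of_real t)"
    by (rule isCont_powser[OF sums_summable[OF s[of "\<bar>t\<bar> + 1"]]]) simp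
  have "isCont complex_of_real t" by (intro continuous_intros)
  from isCont_o2[OF this pw] show ?thesis
    unfolding eq by (rule continuous_at_imp_continuous_at_within)
qed

lemma (in prob_space) cdf_eq_Phi2:
  fixes X :: "'a \<Rightarrow> real" and a b :: "nat \<Rightarrow> complex"
  assumes meas: "X \<in> borel_measurable M"
    and nn: "\<And>\<omega>. \<omega> \<in> space M \<Longrightarrow> X \<omega> \<ge> 0"
    and a: "\<And>i. i < n \<Longrightarrow> Re (a i) > 0"
    and B: "(\<Sum>i<n. b i) = of_real B" "B > 0"
    and mgf: "\<And>s. s \<le> 0 \<Longrightarrow> complex_of_real (expectation (\<lambda>\<omega>. exp (s * X \<omega>)))
          = (\<Prod>i<n. (1 - of_real s / a i) powr (- b i))"
    and t: "t \<ge> 0"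
  shows "complex_of_real (measure M {\<omega>\<in>space M. X \<omega> \<le> t}) =
    (\<Prod>i<n. a i powr b i) / of_real (Gamma (1 + B)) * of_real (t powr B)
      * Phi2 n b (of_real (1 + B)) (\<lambda>i. - a i * of_real t)"
proof -
  define A where "A = (\<Prod>i<n. a i powr b i)"
  define F where "F t = measure M {\<omega>\<in>space M. X \<omega> \<le> t}" for t
  define G where "G t = A / of_real (Gamma (1 + B)) * of_real (t powr B)
      * Phi2 n b (of_real (1 + B)) (\<lambda>i. - a i * of_real t)" for t
  \<comment> \<open>u0 exceeds every |a_i|, so \<open>laplace_Phi2\<close> applies at each u0 +
    k.\<close>
  define u0 where "u0 = 1 + (\<Sum>i<n. norm (a i))"
  have u0: "u0 > 0" unfolding u0_def by (intro add_pos_nonneg sum_nonneg) auto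
  have au: "norm (a i) < u0" if "i < n" for i
    unfolding u0_def using member_le_sum[of i "{..<n}" "\<lambda>i. norm (a i)"] that by simp
  have Gp: "Gamma (1 + B) > 0" using B(2) by (intro Gamma_real_pos) simp
  have lap: "has_bochner_integral lborel (\<lambda>t. indicator {0..} t *\<^sub>R (of_real (exp (- u * t)) * (of_real (F t) - G t))) 0"
    if u: "u \<ge> u0" for u
  proof -
    have u_pos: "u > 0" using u u0 by simp
    have "has_bochner_integral lborel (\<lambda>t. complex_of_real (indicator {0..} t * (exp (- u * t) * F t)))
      (of_real (expectation (\<lambda>\<omega>. exp (- u * X \<omega>)) / u))"
      using laplace_cdf[OF meas nn u_pos] unfolding F_def by (rule has_bochner_integral_of_real)
    moreover have "has_bochner_integral lborel (\<lambda>t. A / of_real (Gamma (1 + B)) *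
        (indicator {0..} t *\<^sub>R (of_real (exp (- u * t) * t powr B) * Phi2 n b (of_real (1 + B)) (\<lambda>i. - a i * of_real t))))
      (A / of_real (Gamma (1 + B)) * (of_real (Gamma (1 + B) * u powr (- (1 + B))) * (\<Prod>i<n. (1 - (- a i) / of_real u) powr (- b i))))"
      using B(2) au u u_pos
      by (intro has_bochner_integral_mult_right laplace_Phi2) (auto intro: less_le_trans[OF au])
    moreover have "A / of_real (Gamma (1 + B)) * (of_real (Gamma (1 + B) * u powr (- (1 + B))) * (\<Prod>i<n. (1 - (- a i) / of_real u) powr (- b i)))
      = of_real (expectation (\<lambda>\<omega>. exp (- u * X \<omega>)) / u)"
    proof -
      have "complex_of_real (expectation (\<lambda>\<omega>. exp (- u * X \<omega>))) = (\<Prod>i<n. (1 + of_real u / a i) powr (- b i))"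
        using mgf[of "- u"] u_pos by simp
      also have "\<dots> = A * of_real (u powr (- B)) * (\<Prod>i<n. (1 + a i / of_real u) powr (- b i))"
        unfolding A_def using a B u_pos by (intro prod_powr_one_plus_inverse) auto
      finally have E: "complex_of_real (expectation (\<lambda>\<omega>. exp (- u * X \<omega>))) =
        A * of_real (u powr (- B)) * (\<Prod>i<n. (1 + a i / of_real u) powr (- b i))" .
      \<comment> \<open>The extra factor 1/u in u^(-(1 + B)) matches the division by u in
        \<open>laplace_cdf\<close>.\<close>
      have "- (1 + B) = - B + - 1" by simp
      then have p: "u powr (- (1 + B)) = u powr (- B) / u"
        using u_pos by (simp only: powr_add) (simp add: powr_minus_divide)
      show ?thesis unfolding of_real_divide E p using Gp u_pos by simp
    qed
    ultimately have "has_bochner_integral lborel (\<lambda>t. complex_of_real (indicator {0..} t * (exp (- u * t) * F t)) -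
       A / of_real (Gamma (1 + B)) *
        (indicator {0..} t *\<^sub>R (of_real (exp (- u * t) * t powr B) * Phi2 n b (of_real (1 + B)) (\<lambda>i. - a i * of_real t)))) 0"
      using has_bochner_integral_diff by fastforce
    also have "(\<lambda>t. complex_of_real (indicator {0..} t * (exp (- u * t) * F t)) -
       A / of_real (Gamma (1 + B)) *
        (indicator {0..} t *\<^sub>R (of_real (exp (- u * t) * t powr B) * Phi2 n b (of_real (1 + B)) (\<lambda>i. - a i * of_real t))))
      = (\<lambda>t. indicator {0..} t *\<^sub>R (of_real (exp (- u * t)) * (of_real (F t) - G t)))"
    proof
      fix t :: real
      show "complex_of_real (indicator {0..} t * (exp (- u * t) * F t)) -
       A / of_real (Gamma (1 + B)) *
        (indicator {0..} t *\<^sub>R (of_real (exp (- u * t) * t powr B) * Phi2 n b (of_real (1 + B)) (\<lambda>i. - a i * of_real t)))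
        = indicator {0..} t *\<^sub>R (of_real (exp (- u * t)) * (of_real (F t) - G t))"
        by (cases "t \<ge> 0") (simp_all add: G_def right_diff_distrib)
    qed
    finally show ?thesis .
  qed
  \<comment> \<open>At t = 0 the value \<open>0 powr B\<close> is 0, which is the limit from the
    right because B > 0.\<close>
  have "continuous (at_right t) (\<lambda>t. t powr B)"
  proof (cases "t = 0")
    case True
    have "((\<lambda>t. t powr B) \<longlongrightarrow> 0 powr B) (at_right 0)"
      using B(2) by (intro tendsto_powr' tendsto_intros) (auto intro!: eventually_mono[OF eventually_at_right_less])
    then show ?thesis using True by (simp add: continuous_within)
  next
    case False
    then have "isCont (\<lambda>t. t powr B) t" by (auto simp: isCont_def intro!: tendsto_intros)
    then show ?thesis by (rule continuous_at_imp_continuous_at_within)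
  qed
  then have "continuous (at_right t) G"
    unfolding G_def using B(2) by (intro continuous_mult continuous_const continuous_of_real continuous_at_right_Phi2) auto
  then have "continuous (at_right t) (\<lambda>t. of_real (F t) - G t)"
    unfolding F_def by (intro continuous_diff continuous_of_real continuous_at_right_cdf meas)
  have "of_real (F t) - G t = 0"
    by (rule laplace_zero[OF lap t \<open>continuous (at_right t) (\<lambda>t. of_real (F t) - G t)\<close>, of u0]) simp
  then show ?thesis by (simp add: F_def G_def A_def)
qed

section \<open>Euler integral and analytic continuation of the Lauricella function\<close>

text \<open>Unnormalised beta law, of total mass \<open>Beta p q\<close> for positive p and q. With
  the endpoint singularities inside the measure, bounded integrands are integrable at once.\<close>

definition beta_measure :: "real \<Rightarrow> real \<Rightarrow> real measure" where
  "beta_measure p q = density lborel (\<lambda>t. ennreal (indicator {0<..<1} t * (t powr (p - 1) * (1 - t) powr (q - 1))))"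

lemma sets_beta_measure [simp, measurable_cong]: "sets (beta_measure p q) = sets borel"
  and space_beta_measure [simp]: "space (beta_measure p q) = UNIV"
  by (simp_all add: beta_measure_def)

text \<open>The density vanishes outside (0, 1), so pointwise facts need checking only
  there.\<close>

lemma AE_beta_measure:
  assumes "\<And>t. 0 < t \<Longrightarrow> t < 1 \<Longrightarrow> P t"
  shows "AE t in beta_measure p q. P t"
  unfolding beta_measure_def
  by (subst AE_density) (auto simp: indicator_def intro!: AE_I2 assms)

lemma nn_integral_Beta:
  assumes "p > 0" "q > (0::real)"
  shows "(\<integral>\<^sup>+ t. ennreal (indicator {0<..<1} t * (t powr (p - 1) * (1 - t) powr (q - 1))) \<partial>lborel) = ennreal (Beta p q)"
  using has_integral_Beta_real[OF assms] unfolding has_integral_Icc_iff_Ioo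
  by (intro nn_integral_has_integral_lebesgue) auto

lemma finite_measure_beta:
  assumes "p > 0" "q > 0"
  shows "finite_measure (beta_measure p q)"
  by (rule finite_measureI)
     (simp add: beta_measure_def emeasure_density nn_integral_Beta[OF assms])

lemma integral_beta_measure:
  fixes f :: "real \<Rightarrow> 'a::{banach, second_countable_topology}"
  assumes "f \<in> borel_measurable borel"
  shows "integral\<^sup>L (beta_measure p q) f =
    integral\<^sup>L lborel (\<lambda>t. (indicator {0<..<1} t * (t powr (p - 1) * (1 - t) powr (q - 1))) *\<^sub>R f t)"
  unfolding beta_measure_def using assms by (subst integral_density) auto

lemma Beta_pos: "p > 0 \<Longrightarrow> q > (0::real) \<Longrightarrow> Beta p q > 0"
  by (simp add: Beta_def Gamma_real_pos)

lemma beta_measure_power: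
  assumes "p > 0" "q > 0"
  shows "integral\<^sup>L (beta_measure p q) (\<lambda>t. t ^ k) = Beta (p + real k) q"
proof -
  have "integral\<^sup>L (beta_measure p q) (\<lambda>t. t ^ k) =
      integral\<^sup>L lborel (\<lambda>t. indicator {0<..<1} t * (t powr (p + real k - 1) * (1 - t) powr (q - 1)))"
  proof (subst integral_beta_measure, simp, intro Bochner_Integration.integral_cong refl)
    fix t :: real
    show "(indicator {0<..<1} t * (t powr (p - 1) * (1 - t) powr (q - 1))) *\<^sub>R t ^ k =
      indicator {0<..<1} t * (t powr (p + real k - 1) * (1 - t) powr (q - 1))"
    proof (cases "t \<in> {0<..<1}")
      case True
      have "t powr (p + real k - 1) = t powr ((p - 1) + real k)" by (simp add: algebra_simps)
      also have "\<dots> = t powr (p - 1) * t ^ k" using True by (simp only: powr_add) (simp add: powr_realpow)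
      finally show ?thesis by simp
    qed simp
  qed
  also have "\<dots> = enn2real (ennreal (Beta (p + real k) q))"
    using assms by (subst integral_eq_nn_integral) (auto simp: nn_integral_Beta)
  also have "\<dots> = Beta (p + real k) q"
    using Beta_pos[of "p + real k" q] assms by simp
  finally show ?thesis .
qed

section \<open>Euler's integrand on the half planes Re x_i < 1\<close>

lemma borel_measurable_powr_complex [measurable]:
  fixes f :: "'a \<Rightarrow> complex"
  assumes [measurable]: "f \<in> borel_measurable M"
  shows "(\<lambda>x. f x powr c) \<in> borel_measurable M"
  unfolding powr_def by measurable

definition FD_kernel :: "nat \<Rightarrow> (nat \<Rightarrow> complex) \<Rightarrow> (nat \<Rightarrow> complex) \<Rightarrow> real \<Rightarrow> complex" where
  "FD_kernel n b x t = (\<Prod>i<n. (1 - x i * of_real t) powr (- b i))"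

lemma measurable_FD_kernel [measurable]: "FD_kernel n b x \<in> borel_measurable borel"
  unfolding FD_kernel_def by measurable

text \<open>The real part is affine in t, so its minimum over [0, 1] is attained at an endpoint,
  with values 1 and 1 - Re z.\<close>

lemma Re_one_minus_mult_ge:
  assumes "t \<in> {0..1}"
  shows "Re (1 - z * of_real t) \<ge> min 1 (1 - Re z)"
proof -
  have "t * Re z \<le> max 0 (Re z)"
  proof (cases "Re z \<ge> 0")
    case True
    then have "t * Re z \<le> 1 * Re z" using assms by (intro mult_right_mono) auto
    then show ?thesis by simp
  next
    case False
    then have "t * Re z \<le> 0" using assms by (intro mult_nonneg_nonpos) auto
    then show ?thesis by simp
  qed
  then show ?thesis by (auto simp: min_def max_def mult.commute split: if_splits)
qed

lemma Re_one_minus_mult_pos: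
  assumes "t \<in> {0..1}" "Re z < 1"
  shows "Re (1 - z * of_real t) > 0"
  using Re_one_minus_mult_ge[OF assms(1), of z] assms(2) by linarith

text \<open>Every base stays off the branch cut for t in [0, 1], so the kernel is continuous on a
  compact interval.\<close>

lemma FD_kernel_bounded:
  assumes "x \<in> FD_dom n"
  obtains K where "\<And>t. 0 < t \<Longrightarrow> t < 1 \<Longrightarrow> norm (FD_kernel n b x t) \<le> K"
proof -
  have "continuous_on {0..1} (FD_kernel n b x)"
    unfolding FD_kernel_def
  proof (intro continuous_on_prod continuous_on_powr_complex continuous_intros)
    fix i assume i: "i \<in> {..<n}"
    show "{0..1} \<subseteq> {t. 0 \<le> Re (1 - x i * of_real t) \<or> Im (1 - x i * of_real t) \<noteq> 0}"
      using Re_one_minus_mult_pos[of _ "x i"] assms i by (force simp: FD_dom_def)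
    show "0 < Re (- b i)" if "t \<in> {0..1}" "1 - x i * of_real t = 0" for t
      using Re_one_minus_mult_pos[OF that(1), of "x i"] assms i that(2) by (auto simp: FD_dom_def)
  qed
  then have "bounded (FD_kernel n b x ` {0..1})"
    by (intro compact_imp_bounded compact_continuous_image) auto
  then show ?thesis using that unfolding bounded_iff
    by (metis (mono_tags, opaque_lifting) atLeastAtMost_iff image_eqI less_imp_le)
qed

text \<open>Euler's integral for F_D with a = p and c = p + q; dividing by \<open>Beta p q\<close>
  gives it the value 1 at the origin when p and q are positive.\<close>

definition FD_euler :: "nat \<Rightarrow> real \<Rightarrow> real \<Rightarrow> (nat \<Rightarrow> complex) \<Rightarrow> (nat \<Rightarrow> complex) \<Rightarrow> complex" where
  "FD_euler n p q b x = integral\<^sup>L (beta_measure p q) (FD_kernel n b x) / of_real (Beta p q)"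

text \<open>The k-th moment of the normalised beta law; it supplies the factor (a)_k / (c)_k of the
  series.\<close>

lemma Beta_pochhammer_ratio:
  assumes "p > 0" "q > (0::real)"
  shows "Beta (p + real k) q / Beta p q = pochhammer p k / pochhammer (p + q) k"
proof -
  have 1: "pochhammer p k = Gamma (p + real k) / Gamma p"
    using assms by (intro pochhammer_Gamma) auto
  have 2: "pochhammer (p + q) k = Gamma (p + q + real k) / Gamma (p + q)"
    using assms by (intro pochhammer_Gamma) auto
  have "Gamma p > 0" "Gamma q > 0" "Gamma (p + q) > 0" "Gamma (p + real k) > 0" "Gamma (p + q + real k) > 0"
    using assms by (auto intro!: Gamma_real_pos)
  then show ?thesis unfolding 1 2 Beta_def
    by (simp add: divide_simps add_ac)
qed

text \<open>Expand the kernel by total degree and integrate termwise. On (0, 1) the powers of t are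
  at most 1, so the moduli of the coefficients dominate; they are summable because r = 1 is
  admissible when all |x_i| < 1.\<close>

lemma FD_euler_eq_series:
  assumes "p > 0" "q > 0" "\<And>i. i < n \<Longrightarrow> norm (x i) < 1"
  shows "FD_euler n p q b x = FD_series n (of_real p) b (of_real (p + q)) x"
proof -
  interpret finite_measure "beta_measure p q" by (rule finite_measure_beta[OF assms(1,2)])
  let ?d = "deg_coeff n b x" and ?M = "beta_measure p q"
  define f where "f k t = ?d k * complex_of_real (t ^ k)" for k t
  have pint: "integrable ?M (\<lambda>t. t ^ k)" for k
    by (rule integrable_const_bound[where B=1])
       (auto intro!: AE_beta_measure power_le_one simp: power_abs)
  have fb: "norm (f k t) \<le> norm (?d k)" if "0 < t" "t < 1" for k t
    using that by (auto simp: f_def norm_mult norm_power intro!: mult_left_le power_le_one)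
  have fint: "integrable ?M (f k)" for k
    unfolding f_def using pint by (intro integrable_mult_right integrable_of_real)
  have fval: "integral\<^sup>L ?M (f k) = ?d k * of_real (Beta (p + real k) q)" for k
    unfolding f_def using beta_measure_power[OF assms(1,2), of k]
    by (simp del: of_real_power)
  have fnorm: "integral\<^sup>L ?M (\<lambda>t. norm (f k t)) \<le> norm (?d k) * measure ?M UNIV" for k
  proof -
    have "integral\<^sup>L ?M (\<lambda>t. norm (f k t)) \<le> integral\<^sup>L ?M (\<lambda>t. norm (?d k))"
      by (intro integral_mono_AE integrable_norm AE_beta_measure fint fb) auto
    then show ?thesis by (simp add: mult.commute)
  qed
  have sd: "summable (\<lambda>k. norm (?d k))"
    using summable_deg_coeff[of 1 n x b] assms by simp
  have fsum: "AE t in ?M. summable (\<lambda>k. norm (f k t))"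
    by (intro AE_beta_measure summable_comparison_test'[OF sd]) (simp add: fb)
  have fint_sum: "summable (\<lambda>k. integral\<^sup>L ?M (\<lambda>t. norm (f k t)))"
    by (rule summable_comparison_test'[OF summable_mult2[OF sd, of "measure ?M UNIV"]]) (use fnorm in auto)
  have "(\<lambda>k. integral\<^sup>L ?M (f k)) sums integral\<^sup>L ?M (\<lambda>t. \<Sum>k. f k t)"
    by (rule sums_integral[OF fint fsum fint_sum])
  also have "integral\<^sup>L ?M (\<lambda>t. \<Sum>k. f k t) = integral\<^sup>L ?M (FD_kernel n b x)"
  proof (rule integral_cong_AE)
    show "AE t in ?M. (\<Sum>k. f k t) = FD_kernel n b x t"
    proof (rule AE_beta_measure)
      fix t :: real assume t: "0 < t" "t < 1"
      have "norm (x i) * t < 1" if "i < n" for i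
        using assms(3)[OF that] t mult_left_le[of t "norm (x i)"] by auto
      then have "(\<lambda>k. ?d k * of_real t ^ k) sums FD_kernel n b x t"
        unfolding FD_kernel_def using t by (intro prod_powr_sums) auto
      then show "(\<Sum>k. f k t) = FD_kernel n b x t"
        by (simp add: f_def sums_iff)
    qed
  qed (use fint in \<open>auto intro: borel_measurable_suminf\<close>)
  finally have "(\<lambda>k. integral\<^sup>L ?M (f k)) sums integral\<^sup>L ?M (FD_kernel n b x)" .
  from sums_divide[OF this, of "of_real (Beta p q)"]
  have "(\<lambda>k. ?d k * of_real (Beta (p + real k) q / Beta p q)) sums FD_euler n p q b x"
    unfolding fval FD_euler_def by simp
  moreover have "(\<lambda>k. ?d k * of_real (Beta (p + real k) q / Beta p q)) sums
      FD_series n (of_real p) b (of_real (p + q)) x"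
  proof -
    have "complex_of_real (Beta (p + real k) q / Beta p q) =
        pochhammer (of_real p) k / pochhammer (of_real (p + q)) k" for k
      unfolding Beta_pochhammer_ratio[OF assms(1,2)] by (simp only: of_real_divide pochhammer_of_real)
    then show ?thesis
      using FD_series_sums[of p "p + q" n x b] assms by (simp only: mult.commute[of "?d _"])
  qed
  ultimately show ?thesis by (rule sums_unique2)
qed

text \<open>Around \<open>z\<^sub>0\<close> the kernel in the variable \<open>x j\<close> is the binomial series in
  \<open>(z - z\<^sub>0) t / (1 - z\<^sub>0 t)\<close>, which converges uniformly in \<open>t\<close>.\<close>

lemma FD_euler_holomorphic:
  assumes pq: "p > 0" "q > 0" and x: "x \<in> FD_dom n" and j: "j < n"
  shows "(\<lambda>z. FD_euler n p q b (x(j := z))) holomorphic_on {z. Re z < 1}"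
proof (rule holomorphic_onI)
  fix z0 assume "z0 \<in> {z. Re z < 1}"
  then have z0: "Re z0 < 1" by simp
  interpret finite_measure "beta_measure p q" by (rule finite_measure_beta[OF pq])
  let ?M = "beta_measure p q" and ?x0 = "x(j := z0)"
  \<comment> \<open>By \<open>Re_one_minus_mult_ge\<close>, r bounds |1 - z0 t| from below uniformly
    in t; it also does not exceed the distance from z0 to the boundary of the half plane.\<close>
  define r where "r = min 1 (1 - Re z0)"
  have r: "r > 0" using z0 by (simp add: r_def)
  define c where "c k = pochhammer (b j) k / fact k" for k
  define y where "y t = of_real t / (1 - z0 * of_real t)" for t
  have [measurable]: "y \<in> borel_measurable borel" unfolding y_def by measurable
  have y: "norm (y t) \<le> 1 / r" if "0 < t" "t < 1" for t
  proof -
    have "r \<le> norm (1 - z0 * of_real t)"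
      using Re_one_minus_mult_ge[of t z0] complex_Re_le_cmod[of "1 - z0 * of_real t"] that
      unfolding r_def by auto
    then show ?thesis using that r unfolding y_def norm_divide
      by (intro frac_le) auto
  qed
  have x0: "?x0 \<in> FD_dom n" using x z0 by (auto simp: FD_dom_def)
  obtain K where K: "\<And>t. 0 < t \<Longrightarrow> t < 1 \<Longrightarrow> norm (FD_kernel n b ?x0 t) \<le> K"
    using FD_kernel_bounded[OF x0] by blast
  have K0: "K \<ge> 0" by (rule order_trans[OF norm_ge_zero K[of "1/2"]]) auto
  define A where "A k = integral\<^sup>L ?M (\<lambda>t. FD_kernel n b ?x0 t * (c k * y t ^ k))" for k
  have sums: "(\<lambda>k. A k * (z - z0) ^ k) sums integral\<^sup>L ?M (FD_kernel n b (x(j := z)))"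
    if z: "z \<in> ball z0 r" for z
  proof -
    define w where "w = z - z0"
    have w: "norm w / r < 1" using z r by (simp add: w_def dist_norm norm_minus_commute)
    define f where "f k t = FD_kernel n b ?x0 t * (c k * (w * y t) ^ k)" for k t
    have [measurable]: "f k \<in> borel_measurable borel" for k unfolding f_def by measurable
    have wy: "norm (w * y t) \<le> norm w / r" if "0 < t" "t < 1" for t
      using mult_left_mono[OF y[OF that] norm_ge_zero[of w]] by (simp add: norm_mult)
    have fb: "norm (f k t) \<le> K * (norm (c k) * (norm w / r) ^ k)" if "0 < t" "t < 1" for k t
      unfolding f_def norm_mult[of "FD_kernel n b ?x0 t"] norm_mult[of "c k"] norm_power[of "w * y t"]
      using K[OF that] wy[OF that] K0
      by (intro mult_mono power_mono mult_nonneg_nonneg) auto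
    have cs: "summable (\<lambda>k. K * (norm (c k) * (norm w / r) ^ k))"
    proof -
      \<comment> \<open>The dominating series is the binomial series at the real point |w| / r <
        1.\<close>
      have "summable (\<lambda>k. norm (pochhammer (b j) k * of_real (norm w / r) ^ k / fact k))"
        using w r by (intro negative_binomial_complex) (simp add: norm_divide)
      then have "summable (\<lambda>k. norm (c k) * (norm w / r) ^ k)"
        using r by (simp add: c_def norm_mult norm_divide norm_power)
      then show ?thesis by (rule summable_mult)
    qed
    have fint: "integrable ?M (f k)" for k
      using fb by (intro integrable_const_bound[where B="K * (norm (c k) * (norm w / r) ^ k)"] AE_beta_measure) auto
    have fnorm: "integral\<^sup>L ?M (\<lambda>t. norm (f k t)) \<le> K * (norm (c k) * (norm w / r) ^ k) * measure ?M UNIV" for k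
    proof -
      have "integral\<^sup>L ?M (\<lambda>t. norm (f k t)) \<le> integral\<^sup>L ?M (\<lambda>t. K * (norm (c k) * (norm w / r) ^ k))"
        by (intro integral_mono_AE integrable_norm fint AE_beta_measure fb) auto
      then show ?thesis by (simp add: mult_ac)
    qed
    have fsum: "AE t in ?M. summable (\<lambda>k. norm (f k t))"
      by (intro AE_beta_measure summable_comparison_test'[OF cs]) (simp add: fb)
    have fint_sum: "summable (\<lambda>k. integral\<^sup>L ?M (\<lambda>t. norm (f k t)))"
      by (rule summable_comparison_test'[OF summable_mult2[OF cs, of "measure ?M UNIV"]]) (use fnorm in auto)
    have "(\<lambda>k. integral\<^sup>L ?M (f k)) sums integral\<^sup>L ?M (\<lambda>t. \<Sum>k. f k t)"
      by (rule sums_integral[OF fint fsum fint_sum])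
    also have "integral\<^sup>L ?M (\<lambda>t. \<Sum>k. f k t) = integral\<^sup>L ?M (FD_kernel n b (x(j := z)))"
    proof (rule integral_cong_AE)
      show "AE t in ?M. (\<Sum>k. f k t) = FD_kernel n b (x(j := z)) t"
      proof (rule AE_beta_measure)
        fix t :: real assume t: "0 < t" "t < 1"
        let ?g = "\<lambda>z. (1 - z * of_real t) powr (- b j)"
        have wy1: "norm (w * y t) < 1" using wy[OF t] w by simp
        have "(\<lambda>k. c k * (w * y t) ^ k) sums ((1 - w * y t) powr (- b j))"
          using negative_binomial_complex(2)[OF wy1, of "b j"] by (simp add: c_def)
        then have "(\<Sum>k. f k t) = FD_kernel n b ?x0 t * (1 - w * y t) powr (- b j)"
          unfolding f_def using sums_mult sums_unique by metis
        moreover have kern: "FD_kernel n b (x(j := v)) t =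
            ?g v * (\<Prod>i\<in>{..<n} - {j}. (1 - x i * of_real t) powr (- b i))" for v
        proof -
          have "FD_kernel n b (x(j := v)) t = ?g v *
             (\<Prod>i\<in>{..<n} - {j}. (1 - (x(j := v)) i * of_real t) powr (- b i))"
            unfolding FD_kernel_def using j by (subst prod.remove[of _ j]) auto
          also have "(\<Prod>i\<in>{..<n} - {j}. (1 - (x(j := v)) i * of_real t) powr (- b i)) =
              (\<Prod>i\<in>{..<n} - {j}. (1 - x i * of_real t) powr (- b i))"
            by (intro prod.cong) auto
          finally show ?thesis .
        qed
        \<comment> \<open>1 - z t = (1 - z0 t)(1 - w y(t)), and both factors have positive real
          part, so the principal power splits.\<close>
        moreover have "?g z = ?g z0 * (1 - w * y t) powr (- b j)"
        proof -
          have pos: "Re (1 - z0 * of_real t) > 0" using t z0 by (intro Re_one_minus_mult_pos) auto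
          then have nz: "1 - z0 * of_real t \<noteq> 0" by (metis less_irrefl zero_complex.sel(1))
          have "Re (1 - w * y t) > 0"
            using wy1 complex_Re_le_cmod[of "w * y t"] by simp
          then have "((1 - z0 * of_real t) * (1 - w * y t)) powr (- b j) = ?g z0 * (1 - w * y t) powr (- b j)"
            using pos by (intro powr_mult_Re_pos)
          moreover have "(1 - z0 * of_real t) * (1 - w * y t) = 1 - z * of_real t"
            using nz by (simp add: y_def w_def field_simps)
          ultimately show ?thesis by simp
        qed
        ultimately show "(\<Sum>k. f k t) = FD_kernel n b (x(j := z)) t"
          by (simp only: kern mult_ac)
      qed
    qed auto
    also have "(\<lambda>k. integral\<^sup>L ?M (f k)) = (\<lambda>k. A k * w ^ k)"
    proof
      fix k
      have "f k = (\<lambda>t. (FD_kernel n b ?x0 t * (c k * y t ^ k)) * w ^ k)"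
        by (simp add: f_def[abs_def] power_mult_distrib mult_ac)
      then show "integral\<^sup>L ?M (f k) = A k * w ^ k" unfolding A_def by simp
    qed
    finally show ?thesis unfolding w_def .
  qed
  \<comment> \<open>The coefficients \<open>A k\<close> do not depend on z, so the integral is
    itself a power series about z0.\<close>
  have "(\<lambda>z. integral\<^sup>L ?M (FD_kernel n b (x(j := z)))) holomorphic_on ball z0 r"
    by (rule power_series_holomorphic) (rule sums)
  then have "(\<lambda>z. FD_euler n p q b (x(j := z))) holomorphic_on ball z0 r"
    unfolding FD_euler_def using Beta_pos[OF pq] by (intro holomorphic_intros) auto
  then show "(\<lambda>z. FD_euler n p q b (x(j := z))) field_differentiable (at z0 within {z. Re z < 1})"
    using r by (intro field_differentiable_at_within[OF holomorphic_on_imp_differentiable_at[OF _ open_ball]]) auto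
qed

text \<open>Holomorphy is only separate, so the one-variable identity theorem is applied once per
  coordinate, extending agreement from the unit disc to the connected half plane while the other
  coordinates stay fixed.\<close>

lemma FD_continuation_unique:
  assumes g: "FD_continuation n a b c g" and h: "FD_continuation n a b c h"
  shows "g = h"
proof
  fix x
  \<comment> \<open>Invariant: the first k coordinates range over the half plane, the others are
    still confined to the unit disc.\<close>
  have step: "g x = h x"
    if "k \<le> n" "\<And>i. i < k \<Longrightarrow> Re (x i) < 1" "\<And>i. k \<le> i \<Longrightarrow> i < n \<Longrightarrow> norm (x i) < 1" for k x
    using that
  proof (induction k arbitrary: x)
    case 0
    then show ?case using g h by (simp add: FD_continuation_def)
  next
    case (Suc k)
    have dom: "x \<in> FD_dom n"
      unfolding FD_dom_def
    proof (clarify)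
      fix i assume "i < n"
      show "Re (x i) < 1"
      proof (cases "i < Suc k")
        case False
        then show ?thesis using Suc.prems(3)[of i] \<open>i < n\<close> complex_Re_le_cmod[of "x i"] by simp
      qed (use Suc.prems in auto)
    qed
    have "g (x(k := x k)) = h (x(k := x k))"
    proof (rule analytic_continuation_open[where f="\<lambda>z. g (x(k := z))" and g="\<lambda>z. h (x(k := z))"])
      show "ball 0 1 \<subseteq> {z. Re z < 1}"
        by (auto simp: dist_norm intro: le_less_trans[OF complex_Re_le_cmod])
      show "connected {z. Re z < 1}" by (intro convex_connected convex_halfspace_Re_lt)
      show "(\<lambda>z. g (x(k := z))) holomorphic_on {z. Re z < 1}" "(\<lambda>z. h (x(k := z))) holomorphic_on {z. Re z < 1}"
        using g h dom Suc.prems(1) by (auto simp: FD_continuation_def)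
      show "g (x(k := z)) = h (x(k := z))" if "z \<in> ball 0 1" for z
        using that Suc.prems by (intro Suc.IH) (auto simp: dist_norm)
    qed (use Suc.prems in \<open>auto simp: open_halfspace_Re_lt\<close>)
    then show ?case by simp
  qed
  show "g x = h x"
  proof (cases "x \<in> FD_dom n")
    case True
    then show ?thesis using step[of n x] by (auto simp: FD_dom_def)
  next
    case False
    then show ?thesis using g h by (simp add: FD_continuation_def)
  qed
qed

text \<open>Euler's integral, set to 0 outside \<open>FD_dom n\<close> as the normalisation demands,
  is a continuation; uniqueness then resolves the definite description.\<close>

lemma lauricella_FD_eq_euler:
  assumes "p > 0" "q > 0" "x \<in> FD_dom n"
  shows "lauricella_FD n (of_real p) b (of_real (p + q)) x = FD_euler n p q b x"
proof -
  define g where "g x = (if x \<in> FD_dom n then FD_euler n p q b x else 0)" for x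
  have "FD_continuation n (of_real p) b (of_real (p + q)) g"
    unfolding FD_continuation_def
  proof (intro conjI allI impI ballI)
    fix x :: "nat \<Rightarrow> complex" assume x: "\<forall>i<n. norm (x i) < 1"
    then have "x \<in> FD_dom n"
      using complex_Re_le_cmod le_less_trans unfolding FD_dom_def by blast
    then show "g x = FD_series n (of_real p) b (of_real (p + q)) x"
      using FD_euler_eq_series[OF assms(1,2)] x by (simp add: g_def)
  next
    fix x j assume "x \<in> FD_dom n" "j < n"
    moreover from this have "x(j := z) \<in> FD_dom n" if "Re z < 1" for z
      using that by (auto simp: FD_dom_def)
    ultimately show "(\<lambda>z. g (x(j := z))) holomorphic_on {z. Re z < 1}"
      using FD_euler_holomorphic[OF assms(1,2)] unfolding g_def
      by (subst holomorphic_cong[OF refl, where g="\<lambda>z. FD_euler n p q b (x(j := z))"]) auto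
  qed (simp add: g_def)
  then have "(THE g. FD_continuation n (of_real p) b (of_real (p + q)) g) = g"
    using FD_continuation_unique by (intro the_equality) auto
  then show ?thesis using assms(3) by (simp add: lauricella_FD_def g_def)
qed

section \<open>Craig's formula and the expectation of the Gaussian Q-function\<close>

lemma nn_integral_exp_square:
  assumes "s > 0"
  shows "(\<integral>\<^sup>+ v. ennreal (indicator {0<..} v * exp (- (s\<^sup>2 * v\<^sup>2) / 2)) \<partial>lborel) = ennreal (sqrt (pi / 2) / s)"
proof -
  \<comment> \<open>This scaling brings the exponent to the form -(c v)^2 of the standard Gaussian
    integral.\<close>
  define c where "c = s / sqrt 2"
  have c: "c > 0" using assms by (simp add: c_def)
  have c2: "(c * v)\<^sup>2 = s\<^sup>2 * v\<^sup>2 / 2" for v by (simp add: c_def power_mult_distrib power_divide)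
  have "has_bochner_integral lborel (\<lambda>v. indicator {0..} (0 + c * v) *\<^sub>R exp (- (0 + c * v)\<^sup>2)) ((sqrt pi / 2) /\<^sub>R \<bar>c\<bar>)"
    using gaussian_moment_0 c by (subst (asm) lborel_has_bochner_integral_real_affine_iff[of c _ _ 0]) auto
  also have "(\<lambda>v. indicator {0..} (0 + c * v) *\<^sub>R exp (- (0 + c * v)\<^sup>2)) = (\<lambda>v. indicator {0..} v * exp (- (s\<^sup>2 * v\<^sup>2) / 2))"
    using c by (auto simp: indicator_def zero_le_mult_iff c2 fun_eq_iff)
  also have "(sqrt pi / 2) /\<^sub>R \<bar>c\<bar> = sqrt (pi / 2) / s"
    using assms by (simp add: c_def real_sqrt_divide field_simps)
  finally have I: "has_bochner_integral lborel (\<lambda>v. indicator {0..} v * exp (- (s\<^sup>2 * v\<^sup>2) / 2)) (sqrt (pi / 2) / s)" .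
  have "(\<integral>\<^sup>+ v. ennreal (indicator {0<..} v * exp (- (s\<^sup>2 * v\<^sup>2) / 2)) \<partial>lborel) =
     (\<integral>\<^sup>+ v. ennreal (indicator {0..} v * exp (- (s\<^sup>2 * v\<^sup>2) / 2)) \<partial>lborel)"
    by (intro nn_integral_cong_AE eventually_mono[OF AE_lborel_singleton[of 0]]) (auto simp: indicator_def)
  also have "\<dots> = ennreal (sqrt (pi / 2) / s)"
    using I assms by (subst nn_integral_eq_integral) (auto simp: has_bochner_integral_iff)
  finally show ?thesis .
qed

lemma nn_integral_exp_tail:
  assumes "w > 0" "x \<ge> 0"
  shows "(\<integral>\<^sup>+ s. ennreal (s * exp (- (s\<^sup>2 * w) / 2)) * indicator {x..} s \<partial>lborel) = ennreal (exp (- (x\<^sup>2 * w) / 2) / w)"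
proof -
  have der: "((\<lambda>s. - exp (- (s\<^sup>2 * w) / 2) / w) has_real_derivative s * exp (- (s\<^sup>2 * w) / 2)) (at s)" for s
  proof -
    have "((\<lambda>s. exp (- (s\<^sup>2 * w) / 2)) has_real_derivative exp (- (s\<^sup>2 * w) / 2) * (- (2 * s * w) / 2)) (at s)"
      by (rule derivative_eq_intros refl | simp)+
    from DERIV_cdivide[OF DERIV_minus[OF this], of w] show ?thesis using assms by (simp add: mult.commute)
  qed
  have "((\<lambda>s. - exp (- (s\<^sup>2 * w) / 2) / w) \<longlongrightarrow> - 0 / w) at_top"
    using assms by (intro tendsto_intros) (real_asymp, simp)
  then have "(\<integral>\<^sup>+ s. ennreal (s * exp (- (s\<^sup>2 * w) / 2)) * indicator {x..} s \<partial>lborel) =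
      ennreal (- 0 / w - (- exp (- (x\<^sup>2 * w) / 2) / w))"
    using assms by (intro nn_integral_FTC_atLeast der) auto
  then show ?thesis by simp
qed

text \<open>Substitute t = 1 / W with W = 1 + v^2, that is t = sin^2 and v = cot of one angle. The
  weight becomes W / v and the Jacobian 2 v / W^2, so their product is 2 / W.\<close>

lemma beta_half_change_of_variables:
  assumes "y \<ge> 0"
  shows "(\<integral>\<^sup>+ v. ennreal (indicator {0<..} v * (2 * (exp (- (y * (1 + v\<^sup>2)) / 2) / (1 + v\<^sup>2)))) \<partial>lborel) =
    ennreal (integral\<^sup>L (beta_measure (1/2) (1/2)) (\<lambda>t. exp (- y / (2 * t))))"
proof -
  define f where "f t = t powr (- 1/2) * (1 - t) powr (- 1/2) * exp (- y / (2 * t))" for t :: real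
  define g where "g v = inverse (1 + v\<^sup>2)" for v :: real
  define g' where "g' v = - (2 * v) * (inverse (1 + v\<^sup>2))\<^sup>2" for v :: real
  have w: "1 + v\<^sup>2 > 0" for v :: real by (simp add: add_pos_nonneg)
  have fm [measurable]: "f \<in> borel_measurable borel" unfolding f_def by measurable
  have set_int: "set_integrable lborel {0<..<1} f"
  proof -
    have "set_integrable lborel {0<..<1} (\<lambda>t. t powr (1/2 - 1) * (1 - t) powr (1/2 - 1) :: real)"
      by (rule set_integrable_subset[OF integrable_Beta]) auto
    then show ?thesis unfolding set_integrable_def
    proof (rule Bochner_Integration.integrable_bound)
      show "AE t in lborel. norm (indicator {0<..<1} t *\<^sub>R f t)
          \<le> norm (indicator {0<..<1} t *\<^sub>R (t powr (1/2 - 1) * (1 - t) powr (1/2 - 1)))"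
        using assms by (intro AE_I2) (auto simp: f_def indicator_def abs_mult intro!: mult_left_le)
    qed simp
  qed
  have val: "integral {0<..<1} f = integral\<^sup>L (beta_measure (1/2) (1/2)) (\<lambda>t. exp (- y / (2 * t)))"
    unfolding set_borel_integral_eq_integral(2)[OF set_int, symmetric] set_lebesgue_integral_def
    by (subst integral_beta_measure) (auto simp: f_def mult_ac intro!: Bochner_Integration.integral_cong)
  have abs: "f absolutely_integrable_on {0<..<1}"
    using set_int unfolding set_integrable_def by (subst integrable_completion) auto
  have img: "g ` {0<..} = {0<..<1}"
  proof (intro equalityI subsetI)
    fix t :: real assume t: "t \<in> {0<..<1}"
    have "t = g (sqrt (1 / t - 1))" using t by (simp add: g_def)
    then show "t \<in> g ` {0<..}" using t by (intro image_eqI[of _ _ "sqrt (1 / t - 1)"]) auto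
  qed (use w in \<open>auto simp: g_def inverse_less_1_iff\<close>)
  have der: "(g has_field_derivative g' v) (at v within {0<..})" for v
    unfolding g_def g'_def using w[of v]
    by (auto intro!: derivative_eq_intros simp: power2_eq_square)
  have inj: "inj_on g {0<..}"
    by (auto simp: inj_on_def g_def power2_eq_iff)
  have "(\<lambda>v. \<bar>g' v\<bar> * f (g v)) absolutely_integrable_on {0<..} \<and>
      integral {0<..} (\<lambda>v. \<bar>g' v\<bar> * f (g v)) = integral {0<..<1} f"
    using has_absolute_integral_change_of_variables_1'[of "{0<..}" g g' f "integral {0<..<1} f"] der inj abs
    unfolding img by auto
  then have hi: "((\<lambda>v. \<bar>g' v\<bar> * f (g v)) has_integral (integral {0<..<1} f)) {0<..}"
    using absolutely_integrable_on_def integrable_integral by metis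
  have eq: "\<bar>g' v\<bar> * f (g v) = 2 * (exp (- (y * (1 + v\<^sup>2)) / 2) / (1 + v\<^sup>2))" if "v \<in> {0<..}" for v
  proof -
    have v: "v > 0" using that by simp
    define W where "W = 1 + v\<^sup>2"
    have W: "W > 0" using w by (simp add: W_def)
    have h: "z powr (- 1/2) = inverse (sqrt z)" if "z > 0" for z :: real
      using that powr_minus[of z "1/2"] by (simp add: powr_half_sqrt)
    have 1: "(inverse W) powr (- 1/2) = sqrt W"
      using h[of "inverse W"] W by (simp add: real_sqrt_inverse)
    have "1 - inverse W = v\<^sup>2 / W" using W by (simp add: W_def field_simps)
    then have 2: "(1 - inverse W) powr (- 1/2) = sqrt W / v"
      using h[of "v\<^sup>2 / W"] W v by (simp add: real_sqrt_divide)
    have 3: "- y / (2 * inverse W) = - y * W / 2" using W by (simp add: field_simps)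
    have "\<bar>g' v\<bar> * f (g v) = 2 * v * (inverse W)\<^sup>2 * (sqrt W * (sqrt W / v) * exp (- y * W / 2))"
      unfolding g_def g'_def f_def W_def[symmetric] 1 2 3 using v W by (simp add: abs_mult)
    also have "\<dots> = 2 * (inverse W)\<^sup>2 * (sqrt W * sqrt W) * exp (- y * W / 2)"
      using v by simp
    also have "\<dots> = 2 * (exp (- (y * W) / 2) / W)"
      using W by (simp add: field_simps power2_eq_square)
    finally show ?thesis by (simp add: W_def)
  qed
  have "((\<lambda>v. 2 * (exp (- (y * (1 + v\<^sup>2)) / 2) / (1 + v\<^sup>2))) has_integral (integral {0<..<1} f)) {0<..}"
    by (rule has_integral_eq[OF eq hi])
  from nn_integral_has_integral_lebesgue[OF _ this] show ?thesis
    using w unfolding val by (simp add: less_imp_le)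
qed

text \<open>Write exp(-x^2 W / 2) / W with W = 1 + v^2 as the integral of s exp(-s^2 W / 2) over s
  >= x and exchange the integrals. The Gaussian integral in v is sqrt(pi/2) / s, which cancels the
  factor s and leaves the tail defining Q. With nonnegative integrals the exchange needs only
  measurability.\<close>

lemma Qfun_sqrt:
  assumes "y \<ge> 0"
  shows "Qfun (sqrt y) = integral\<^sup>L (beta_measure (1/2) (1/2)) (\<lambda>t. exp (- y / (2 * t))) / (2 * pi)"
proof -
  define x where "x = sqrt y"
  have x: "x \<ge> 0" "x\<^sup>2 = y" using assms by (auto simp: x_def)
  define N where "N = (\<integral>\<^sup>+ s. ennreal (indicator {x..} s * exp (- (s\<^sup>2) / 2)) \<partial>lborel)"
  define I where "I = integral\<^sup>L (beta_measure (1/2) (1/2)) (\<lambda>t. exp (- y / (2 * t)))"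
  have w: "1 + v\<^sup>2 > 0" for v :: real by (simp add: add_pos_nonneg)
  have "ennreal I = (\<integral>\<^sup>+ v. ennreal (2 * indicator {0<..} v) * ennreal (exp (- (x\<^sup>2 * (1 + v\<^sup>2)) / 2) / (1 + v\<^sup>2)) \<partial>lborel)"
    unfolding I_def beta_half_change_of_variables[OF assms, symmetric] x(2)
    using w by (intro nn_integral_cong) (auto simp: indicator_def ennreal_mult[symmetric] less_imp_le)
  also have "\<dots> = (\<integral>\<^sup>+ v. ennreal (2 * indicator {0<..} v) *
      (\<integral>\<^sup>+ s. ennreal (s * exp (- (s\<^sup>2 * (1 + v\<^sup>2)) / 2)) * indicator {x..} s \<partial>lborel) \<partial>lborel)"
    by (simp only: nn_integral_exp_tail[OF w x(1)])
  also have "\<dots> = (\<integral>\<^sup>+ v. (\<integral>\<^sup>+ s. ennreal (2 * indicator {0<..} v) *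
      (ennreal (s * exp (- (s\<^sup>2 * (1 + v\<^sup>2)) / 2)) * indicator {x..} s) \<partial>lborel) \<partial>lborel)"
    by (intro nn_integral_cong nn_integral_cmult[symmetric]) simp
  also have "\<dots> = (\<integral>\<^sup>+ s. (\<integral>\<^sup>+ v. ennreal (2 * indicator {0<..} v) *
      (ennreal (s * exp (- (s\<^sup>2 * (1 + v\<^sup>2)) / 2)) * indicator {x..} s) \<partial>lborel) \<partial>lborel)"
    by (rule lborel_pair.Fubini'[symmetric]) simp
  also have "\<dots> = (\<integral>\<^sup>+ s. ennreal (2 * sqrt (pi / 2)) * ennreal (indicator {x..} s * exp (- (s\<^sup>2) / 2)) \<partial>lborel)"
  \<comment> \<open>The point s = 0 is discarded as a null set: for x = 0 the factor s makes the
    left side vanish there, but not the right.\<close>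
  proof (rule nn_integral_cong_AE, rule eventually_mono[OF AE_lborel_singleton[of 0]])
    fix s :: real assume s: "s \<noteq> 0"
    show "(\<integral>\<^sup>+ v. ennreal (2 * indicator {0<..} v) *
      (ennreal (s * exp (- (s\<^sup>2 * (1 + v\<^sup>2)) / 2)) * indicator {x..} s) \<partial>lborel)
      = ennreal (2 * sqrt (pi / 2)) * ennreal (indicator {x..} s * exp (- (s\<^sup>2) / 2))"
    proof (cases "s \<ge> x")
      case True
      then have s: "s > 0" using s x by simp
      have "(\<integral>\<^sup>+ v. ennreal (2 * indicator {0<..} v) * (ennreal (s * exp (- (s\<^sup>2 * (1 + v\<^sup>2)) / 2)) * indicator {x..} s) \<partial>lborel)
        = (\<integral>\<^sup>+ v. ennreal (2 * s * exp (- (s\<^sup>2) / 2)) * ennreal (indicator {0<..} v * exp (- (s\<^sup>2 * v\<^sup>2) / 2)) \<partial>lborel)"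
      proof (intro nn_integral_cong)
        fix v :: real
        have "- (s\<^sup>2 * (1 + v\<^sup>2)) / 2 = - (s\<^sup>2) / 2 + - (s\<^sup>2 * v\<^sup>2) / 2" by (simp add: field_simps)
        then have e: "exp (- (s\<^sup>2 * (1 + v\<^sup>2)) / 2) = exp (- (s\<^sup>2) / 2) * exp (- (s\<^sup>2 * v\<^sup>2) / 2)"
          by (simp only: exp_add)
        show "ennreal (2 * indicator {0<..} v) * (ennreal (s * exp (- (s\<^sup>2 * (1 + v\<^sup>2)) / 2)) * indicator {x..} s) =
          ennreal (2 * s * exp (- (s\<^sup>2) / 2)) * ennreal (indicator {0<..} v * exp (- (s\<^sup>2 * v\<^sup>2) / 2))"
        proof (cases "v > 0")
          case True
          then show ?thesis using \<open>s \<ge> x\<close> s unfolding e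
            using ennreal_mult[of 2 "s * (exp (- (s\<^sup>2) / 2) * exp (- (s\<^sup>2 * v\<^sup>2) / 2))"]
            by (simp add: ennreal_mult[symmetric] mult_ac)
        qed simp
      qed
      also have "\<dots> = ennreal (2 * s * exp (- (s\<^sup>2) / 2)) * ennreal (sqrt (pi / 2) / s)"
        by (subst nn_integral_cmult) (simp_all only: nn_integral_exp_square[OF s], simp)
      also have "\<dots> = ennreal (2 * sqrt (pi / 2)) * ennreal (indicator {x..} s * exp (- (s\<^sup>2) / 2))"
        using True s by (simp add: ennreal_mult[symmetric])
      finally show ?thesis .
    qed simp
  qed
  also have "\<dots> = ennreal (2 * sqrt (pi / 2)) * N"
    unfolding N_def by (rule nn_integral_cmult) simp
  finally have *: "ennreal I = ennreal (2 * sqrt (pi / 2)) * N" .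
  have "I \<ge> 0" unfolding I_def by (intro integral_nonneg_AE AE_I2) simp
  then have I: "I = 2 * sqrt (pi / 2) * enn2real N"
    using arg_cong[OF *, of enn2real] by (simp add: enn2real_mult)
  have "Qfun x = 1 / sqrt (2 * pi) * enn2real N"
    unfolding Qfun_def N_def set_lebesgue_integral_def
    by (subst integral_eq_nn_integral) auto
  also have "\<dots> = I / (2 * pi)"
  proof -
    have "sqrt (pi / 2) * sqrt (2 * pi) = sqrt (pi\<^sup>2)"
      unfolding real_sqrt_mult[symmetric] by (simp add: power2_eq_square)
    then have "sqrt (pi / 2) * sqrt (2 * pi) = pi" by simp
    then have "1 / sqrt (2 * pi) = 2 * sqrt (pi / 2) / (2 * pi)"
      by (subst frac_eq_eq) auto
    then show ?thesis by (simp only: I times_divide_eq_left)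
  qed
  finally show ?thesis unfolding x_def I_def .
qed

text \<open>After Craig's formula and Fubini the generating function is evaluated at s = -p / (2 t),
  which is negative for every t in (0, 1), hence in the range where it is known.\<close>

lemma (in prob_space) expectation_Qfun_eq_FD:
  fixes X :: "'a \<Rightarrow> real" and a b :: "nat \<Rightarrow> complex"
  assumes meas [measurable]: "X \<in> borel_measurable M"
    and nn: "\<And>\<omega>. \<omega> \<in> space M \<Longrightarrow> X \<omega> \<ge> 0"
    and a: "\<And>i. i < n \<Longrightarrow> Re (a i) > 0"
    and B: "(\<Sum>i<n. b i) = of_real B" "B > 0"
    and mgf: "\<And>s. s \<le> 0 \<Longrightarrow> complex_of_real (expectation (\<lambda>\<omega>. exp (s * X \<omega>)))
          = (\<Prod>i<n. (1 - of_real s / a i) powr (- b i))"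
    and p: "p > 0"
  shows "complex_of_real (expectation (\<lambda>\<omega>. Qfun (sqrt (p * X \<omega>)))) =
    1 / (2 * of_real (sqrt pi)) * (\<Prod>i<n. a i powr b i)
      * of_real (Gamma (1/2 + B) / Gamma (1 + B)) * of_real ((2 / p) powr B)
      * lauricella_FD n (of_real (1/2 + B)) b (of_real (1 + B)) (\<lambda>i. - 2 * a i / of_real p)"
proof -
  let ?\<beta> = "beta_measure (1/2) (1/2)"
  define A where "A = (\<Prod>i<n. a i powr b i)"
  define x where "x = (\<lambda>i. - 2 * a i / complex_of_real p)"
  interpret \<beta>: finite_measure ?\<beta> by (rule finite_measure_beta) auto
  interpret P: pair_sigma_finite ?\<beta> M ..
  interpret PF: finite_measure "?\<beta> \<Otimes>\<^sub>M M"
    by (rule finite_measure_pair_measure[OF finite_measure_axioms \<beta>.finite_measure_axioms])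
  \<comment> \<open>Each x_i has negative real part, though its modulus may exceed 1.\<close>
  have dom: "x \<in> FD_dom n"
  proof -
    have "Re (x i) < 1" if "i < n" for i
    proof -
      have "0 \<le> Re (a i) / p" using a[OF that] p by simp
      moreover have "Re (x i) = - 2 * (Re (a i) / p)" by (simp add: x_def)
      ultimately show ?thesis by linarith
    qed
    then show ?thesis by (simp add: FD_dom_def)
  qed
  have "expectation (\<lambda>\<omega>. Qfun (sqrt (p * X \<omega>))) =
      expectation (\<lambda>\<omega>. integral\<^sup>L ?\<beta> (\<lambda>t. exp (- (p * X \<omega>) / (2 * t))) / (2 * pi))"
    by (intro Bochner_Integration.integral_cong refl Qfun_sqrt mult_nonneg_nonneg less_imp_le[OF p] nn)
  also have "\<dots> = expectation (\<lambda>\<omega>. integral\<^sup>L ?\<beta> (\<lambda>t. exp (- (p * X \<omega>) / (2 * t)))) / (2 * pi)"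
    by (rule integral_divide_zero)
  also have "expectation (\<lambda>\<omega>. integral\<^sup>L ?\<beta> (\<lambda>t. exp (- (p * X \<omega>) / (2 * t)))) =
     integral\<^sup>L ?\<beta> (\<lambda>t. expectation (\<lambda>\<omega>. exp (- (p * X \<omega>) / (2 * t))))"
  proof (rule P.Fubini_integral)
    \<comment> \<open>The exponent is nonpositive, so the integrand is bounded by 1 on a finite
      product measure.\<close>
    have "AE z in ?\<beta> \<Otimes>\<^sub>M M. norm (case z of (t, \<omega>) \<Rightarrow> exp (- (p * X \<omega>) / (2 * t))) \<le> 1"
    proof (rule P.AE_pair_measure)
      show "AE t in ?\<beta>. AE \<omega> in M. norm (case (t, \<omega>) of (t, \<omega>) \<Rightarrow> exp (- (p * X \<omega>) / (2 * t))) \<le> 1"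
        using nn p by (intro AE_beta_measure AE_I2) auto
    qed measurable
    then show "integrable (?\<beta> \<Otimes>\<^sub>M M) (\<lambda>(t, \<omega>). exp (- (p * X \<omega>) / (2 * t)))"
      by (rule PF.integrable_const_bound) measurable
  qed
  finally have E: "complex_of_real (expectation (\<lambda>\<omega>. Qfun (sqrt (p * X \<omega>)))) =
      integral\<^sup>L ?\<beta> (\<lambda>t. complex_of_real (expectation (\<lambda>\<omega>. exp (- (p * X \<omega>) / (2 * t))))) / of_real (2 * pi)"
    by simp
  have "integral\<^sup>L ?\<beta> (\<lambda>t. complex_of_real (expectation (\<lambda>\<omega>. exp (- (p * X \<omega>) / (2 * t))))) =
    integral\<^sup>L ?\<beta> (\<lambda>t. (A * of_real ((2 / p) powr B)) * (of_real (t powr B) * FD_kernel n b x t))"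
  proof (rule integral_cong_AE)
    show "AE t in ?\<beta>. complex_of_real (expectation (\<lambda>\<omega>. exp (- (p * X \<omega>) / (2 * t)))) =
       (A * of_real ((2 / p) powr B)) * (of_real (t powr B) * FD_kernel n b x t)"
    proof (rule AE_beta_measure)
      fix t :: real assume t: "0 < t" "t < 1"
      \<comment> \<open>With this r, a_i / r = -x_i t yields the Euler kernel, and r^(-B) = (2/p)^B
        t^B.\<close>
      define r where "r = p / (2 * t)"
      have r: "r > 0" using t p by (simp add: r_def)
      have "complex_of_real (expectation (\<lambda>\<omega>. exp (- (p * X \<omega>) / (2 * t)))) = (\<Prod>i<n. (1 + of_real r / a i) powr (- b i))"
        using mgf[of "- r"] r by (simp add: r_def)
      also have "\<dots> = A * of_real (r powr (- B)) * (\<Prod>i<n. (1 + a i / of_real r) powr (- b i))"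
        unfolding A_def using a r B(1) by (rule prod_powr_one_plus_inverse)
      also have "(\<Prod>i<n. (1 + a i / of_real r) powr (- b i)) = FD_kernel n b x t"
        using p t by (simp add: FD_kernel_def x_def r_def mult_ac)
      also have "r powr (- B) = (2 / p) powr B * t powr B"
      proof -
        have "r powr (- B) = (inverse r) powr B" using r by (simp add: powr_minus inverse_powr)
        also have "inverse r = (2 / p) * t" by (simp add: r_def)
        finally show ?thesis using powr_mult[of "2 / p" t B] p t by simp
      qed
      finally show "complex_of_real (expectation (\<lambda>\<omega>. exp (- (p * X \<omega>) / (2 * t)))) =
         (A * of_real ((2 / p) powr B)) * (of_real (t powr B) * FD_kernel n b x t)" by simp
    qed
  qed measurable
  also have "\<dots> = (A * of_real ((2 / p) powr B)) * integral\<^sup>L ?\<beta> (\<lambda>t. of_real (t powr B) * FD_kernel n b x t)"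
    by (rule integral_mult_right_zero)
  also have "integral\<^sup>L ?\<beta> (\<lambda>t. of_real (t powr B) * FD_kernel n b x t) =
      integral\<^sup>L (beta_measure (1/2 + B) (1/2)) (FD_kernel n b x)"
  proof -
    have "(indicator {0<..<1} t * (t powr (1/2 - 1) * (1 - t) powr (1/2 - 1))) *\<^sub>R (of_real (t powr B) * FD_kernel n b x t) =
      (indicator {0<..<1} t * (t powr (1/2 + B - 1) * (1 - t) powr (1/2 - 1))) *\<^sub>R FD_kernel n b x t" for t :: real
    proof -
      \<comment> \<open>The factor t^B is absorbed into the weight and raises the first beta
        parameter by B.\<close>
      have "1/2 + B - 1 = (1/2 - 1) + B" by simp
      then have "t powr (1/2 + B - 1) = t powr (1/2 - 1) * t powr B" by (simp only: powr_add)
      then show ?thesis by (simp add: scaleR_conv_of_real mult_ac)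
    qed
    then show ?thesis by (simp add: integral_beta_measure)
  qed
  also have "\<dots> = of_real (Beta (1/2 + B) (1/2)) * FD_euler n (1/2 + B) (1/2) b x"
    using Beta_pos[of "1/2 + B" "1/2"] B(2) by (simp add: FD_euler_def)
  also have "FD_euler n (1/2 + B) (1/2) b x = lauricella_FD n (of_real (1/2 + B)) b (of_real (1 + B)) x"
    using lauricella_FD_eq_euler[of "1/2 + B" "1/2" x n b] dom B(2) by simp
  finally have F: "integral\<^sup>L ?\<beta> (\<lambda>t. complex_of_real (expectation (\<lambda>\<omega>. exp (- (p * X \<omega>) / (2 * t))))) =
    A * of_real ((2 / p) powr B) * (of_real (Beta (1/2 + B) (1/2)) * lauricella_FD n (of_real (1/2 + B)) b (of_real (1 + B)) x)" .
  \<comment> \<open>The value Gamma(1/2) = sqrt pi inside the Beta function, divided by the 2 pi of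
    Craig's formula, leaves 1 / (2 sqrt pi).\<close>
  have G: "Beta (1/2 + B) (1/2) / (2 * pi) = 1 / (2 * sqrt pi) * (Gamma (1/2 + B) / Gamma (1 + B))"
  proof -
    define C where "C = Gamma (1/2 + B) / Gamma (1 + B)"
    have 1: "Beta (1/2 + B) (1/2) = C * sqrt pi"
      by (simp add: C_def Beta_def Gamma_one_half_real add_ac)
    have 2: "sqrt pi / (2 * pi) = 1 / (2 * sqrt pi)"
      by (simp add: field_simps)
    have "C * sqrt pi / (2 * pi) = C * (sqrt pi / (2 * pi))" by simp
    then show ?thesis unfolding 1 2 C_def[symmetric] by (simp only: mult.commute)
  qed
  have "complex_of_real (expectation (\<lambda>\<omega>. Qfun (sqrt (p * X \<omega>)))) =
    of_real (Beta (1/2 + B) (1/2) / (2 * pi)) * A * of_real ((2 / p) powr B)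
      * lauricella_FD n (of_real (1/2 + B)) b (of_real (1 + B)) x"
    unfolding E F of_real_divide[of _ "2 * pi"] by simp
  then show ?thesis unfolding G A_def x_def by (simp add: mult_ac)
qed

theorem theorem1:
  fixes M :: "'w measure" and X :: "'w \<Rightarrow> real"
    and n :: nat and a b :: "nat \<Rightarrow> complex" and B :: real
  assumes "prob_space M"
    and "X \<in> borel_measurable M"
    and "\<forall>\<omega>\<in>space M. X \<omega> \<ge> 0"
    and "\<forall>i<n. Re (a i) > 0"
    and "(\<Sum>i<n. b i) = complex_of_real B" and "B > 0"
    and mgf: "\<forall>s::real. s \<le> 0 \<longrightarrow>
        complex_of_real (prob_space.expectation M (\<lambda>\<omega>. exp (s * X \<omega>)))
          = (\<Prod>i<n. (1 - complex_of_real s / a i) powr (- b i))"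
  shows "(\<forall>x::real. x \<ge> 0 \<longrightarrow>
            complex_of_real (measure M {\<omega>\<in>space M. X \<omega> \<le> x})
              = (\<Prod>i<n. a i powr b i) / complex_of_real (Gamma (1 + B))
                * complex_of_real (x powr B)
                * Phi2 n b (complex_of_real (1 + B)) (\<lambda>i. - a i * complex_of_real x))
       \<and> (\<forall>p::real. p > 0 \<longrightarrow>
            complex_of_real (prob_space.expectation M (\<lambda>\<omega>. Qfun (sqrt (p * X \<omega>))))
              = 1 / (2 * complex_of_real (sqrt pi)) * (\<Prod>i<n. a i powr b i)
                * complex_of_real (Gamma (1/2 + B) / Gamma (1 + B))
                * complex_of_real ((2 / p) powr B)
                * lauricella_FD n (complex_of_real (1/2 + B)) b (complex_of_real (1 + B))
                    (\<lambda>i. - 2 * a i / complex_of_real p))"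
proof -
  interpret prob_space M by fact
  have nn: "\<And>\<omega>. \<omega> \<in> space M \<Longrightarrow> X \<omega> \<ge> 0"
    and a: "\<And>i. i < n \<Longrightarrow> Re (a i) > 0"
    and m: "\<And>s. s \<le> 0 \<Longrightarrow> complex_of_real (expectation (\<lambda>\<omega>. exp (s * X \<omega>)))
          = (\<Prod>i<n. (1 - of_real s / a i) powr (- b i))"
    using assms(3,4,7) by auto
  show ?thesis
    using cdf_eq_Phi2[OF assms(2) nn a assms(5,6) m] expectation_Qfun_eq_FD[OF assms(2) nn a assms(5,6) m]
    by blast
qed

end
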